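(* Let $$E=\begin{pmatrix}[2]_qb_-\\ 1+[2]_qb_0\\ [2]_qb_+\end{pmatrix}\begin{pmatrix}-b_+, & 1+[2]_qb_0, & -q^2b_-\end{pmatrix}\in M_3(\mathbb{C}_q[S^2]).$$ Then $E$ is a projector ($E^2=E$) and yields $\Omega^1(\mathbb{C}_q[S^2])\cong\mathbb{C}_q[S^2]^{\oplus3}(1-E)$ as left $\mathbb{C}_q[S^2]$-modules, via $(f,g,h)\mapsto f\,\mathrm{d}b_-+g\,\mathrm{d}b_0+h\,\mathrm{d}b_+$ on row vectors, and $\nabla=-E\,\mathrm{d}E$ acting on $\mathrm{d}b_-,\mathrm{d}b_0,\mathrm{d}b_+$, i.e. $$\nabla\begin{pmatrix}\mathrm{d}b_-\\ \mathrm{d}b_0\\ \mathrm{d}b_+\end{pmatrix}=-E\,(\mathrm{d}E)\,\bar\otimes\begin{pmatrix}\mathrm{d}b_-\\ \mathrm{d}b_0\\ \mathrm{d}b_+\end{pmatrix}.$$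
   Context: $q\in\mathbb{C}$ is invertible and $[2]_q=q+q^{-1}$; $\bar\otimes$ is the tensor product over $\mathbb{C}_q[S^2]$. $\mathbb{C}_q[SL_2]$ is the Hopf algebra generated by $a,b,c,d$ with $ba=qab$, $ca=qac$, $db=qbd$, $dc=qcd$, $bc=cb$, $ad=1+q^{-1}bc$, $da=1+qbc$. It is $\mathbb{Z}$-graded by $\deg a=\deg c=1$, $\deg b=\deg d=-1$. $\mathbb{C}_q[S^2]$ is the degree $0$ subalgebra, generated by $b_0=bc$, $b_+=cd$, $b_-=ab$. $\Omega^1(\mathbb{C}_q[SL_2])$ is the bimodule calculus that is free as a left module on $e^+,e^-,e^0$, with $e^\pm x=q^{\deg x}x\,e^\pm$ and $e^0x=q^{2\deg x}x\,e^0$ for homogeneous $x$, and $$\mathrm{d}a=ae^0+qbe^+,\quad \mathrm{d}b=ae^--q^{-2}be^0,\quad \mathrm{d}c=ce^0+qde^+,\quad \mathrm{d}d=ce^--q^{-2}de^0.$$ $\Omega^1(\mathbb{C}_q[S^2])=\mathrm{span}\{m\,\mathrm{d}n: m,n\in\mathbb{C}_q[S^2]\}\subset\Omega^1(\mathbb{C}_q[SL_2])$. $\nabla:\Omega^1(\mathbb{C}_q[S^2])\to\Omega^1(\mathbb{C}_q[S^2])\bar\otimes\Omega^1(\mathbb{C}_q[S^2])$ is the connection (obeying $\nabla(m\tau)=\mathrm{d}m\bar\otimes\tau+m\nabla\tau$) induced by the $q$-monopole, given by $\nabla(\mathrm{d}b_\pm)=[2]_qb_\pm\,g$, $\nabla(\mathrm{d}b_0)=(1+[2]_qb_0)\,g$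 with $g=q^2\,\mathrm{d}b_-\bar\otimes\mathrm{d}b_++\mathrm{d}b_+\bar\otimes\mathrm{d}b_--[2]_q\,\mathrm{d}b_0\bar\otimes\mathrm{d}b_0$. *)

theory Defs
  imports "HOL-Algebra.Algebra" "HOL-Library.Poly_Mapping" "HOL.Complex"
begin

section \<open>Generic noncommutative module theory over rings with carriers\<close>

text \<open>
  The library's \<^const>\<open>module\<close> locale demands commutative scalars, so only its record type is used,
  as the data of a left module (the unused ring fields are \<^const>\<open>undefined\<close>), and extended by a
  right action for bimodules.
\<close>

record ('r, 'm) bimodule = "('r, 'm) module" +
  rsmult :: "'m \<Rightarrow> 'r \<Rightarrow> 'm"  (infixl \<open>\<triangleleft>\<index>\<close> 70)

definition left_module_iso ::
  "('r, 'e) ring_scheme \<Rightarrow> ('r, 'm, 'e1) module_scheme \<Rightarrow> ('r, 'n, 'e2) module_scheme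
    \<Rightarrow> ('m \<Rightarrow> 'n) \<Rightarrow> bool" where
  "left_module_iso R M N f \<longleftrightarrow>
     bij_betw f (carrier M) (carrier N) \<and>
     (\<forall>x\<in>carrier M. \<forall>y\<in>carrier M. f (x \<oplus>\<^bsub>M\<^esub> y) = f x \<oplus>\<^bsub>N\<^esub> f y) \<and>
     (\<forall>r\<in>carrier R. \<forall>x\<in>carrier M. f (r \<odot>\<^bsub>M\<^esub> x) = r \<odot>\<^bsub>N\<^esub> f x)"

text \<open>
  The balanced tensor product of an \<open>R\<close>-bimodule \<open>M\<close> with a left \<open>R\<close>-module \<open>N\<close>: the free abelian
  group on pairs modulo biadditivity and \<open>(x r, y) = (x, r y)\<close>, a left module through \<open>M\<close>.
\<close>

definition tensor_relators ::
  "('r, 'e) ring_scheme \<Rightarrow> ('r, 'm, 'e1) bimodule_scheme \<Rightarrow> ('r, 'n, 'e2) module_scheme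
    \<Rightarrow> ('m \<times> 'n \<Rightarrow>\<^sub>0 int) set" where
  "tensor_relators R M N =
     {frag_of (x \<oplus>\<^bsub>M\<^esub> x', y) - frag_of (x, y) - frag_of (x', y) | x x' y.
        x \<in> carrier M \<and> x' \<in> carrier M \<and> y \<in> carrier N} \<union>
     {frag_of (x, y \<oplus>\<^bsub>N\<^esub> y') - frag_of (x, y) - frag_of (x, y') | x y y'.
        x \<in> carrier M \<and> y \<in> carrier N \<and> y' \<in> carrier N} \<union>
     {frag_of (x \<triangleleft>\<^bsub>M\<^esub> r, y) - frag_of (x, r \<odot>\<^bsub>N\<^esub> y) | x r y.
        x \<in> carrier M \<and> r \<in> carrier R \<and> y \<in> carrier N}"

definition tensor_kernel ::
  "('r, 'e) ring_scheme \<Rightarrow> ('r, 'm, 'e1) bimodule_scheme \<Rightarrow> ('r, 'n, 'e2) module_scheme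
    \<Rightarrow> ('m \<times> 'n \<Rightarrow>\<^sub>0 int) set" where
  "tensor_kernel R M N =
     generate (free_Abelian_group (carrier M \<times> carrier N)) (tensor_relators R M N)"

definition tensor_class ::
  "('r, 'e) ring_scheme \<Rightarrow> ('r, 'm, 'e1) bimodule_scheme \<Rightarrow> ('r, 'n, 'e2) module_scheme
    \<Rightarrow> ('m \<times> 'n \<Rightarrow>\<^sub>0 int) \<Rightarrow> ('m \<times> 'n \<Rightarrow>\<^sub>0 int) set" where
  "tensor_class R M N p =
     tensor_kernel R M N #>\<^bsub>free_Abelian_group (carrier M \<times> carrier N)\<^esub> p"

definition pure_tensor ::
  "('r, 'e) ring_scheme \<Rightarrow> ('r, 'm, 'e1) bimodule_scheme \<Rightarrow> ('r, 'n, 'e2) module_scheme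
    \<Rightarrow> 'm \<Rightarrow> 'n \<Rightarrow> ('m \<times> 'n \<Rightarrow>\<^sub>0 int) set" where
  "pure_tensor R M N x y = tensor_class R M N (frag_of (x, y))"

definition tensor_product ::
  "('r, 'e) ring_scheme \<Rightarrow> ('r, 'm, 'e1) bimodule_scheme \<Rightarrow> ('r, 'n, 'e2) module_scheme
    \<Rightarrow> ('r, ('m \<times> 'n \<Rightarrow>\<^sub>0 int) set) module" where
  "tensor_product R M N =
     (let Q = free_Abelian_group (carrier M \<times> carrier N) Mod tensor_kernel R M N in
      \<lparr>carrier = carrier Q, monoid.mult = undefined, one = undefined,
       ring.zero = \<one>\<^bsub>Q\<^esub>, add = (\<otimes>\<^bsub>Q\<^esub>),
       smult = (\<lambda>r C. the_elem
         ((\<lambda>p. tensor_class R M N (frag_extend (\<lambda>(x, y). frag_of (r \<odot>\<^bsub>M\<^esub> x, y)) p)) ` C))\<rparr>)"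

text \<open>Matrices and row vectors, indexed by a finite type.\<close>

definition mat_ring :: "('r, 'e) ring_scheme \<Rightarrow> ('i::finite \<Rightarrow> 'i \<Rightarrow> 'r) ring" where
  "mat_ring R =
     \<lparr>carrier = {A. \<forall>i j. A i j \<in> carrier R},
      monoid.mult = (\<lambda>A B i j. \<Oplus>\<^bsub>R\<^esub>k\<in>UNIV. A i k \<otimes>\<^bsub>R\<^esub> B k j),
      one = (\<lambda>i j. if i = j then \<one>\<^bsub>R\<^esub> else \<zero>\<^bsub>R\<^esub>),
      ring.zero = (\<lambda>i j. \<zero>\<^bsub>R\<^esub>),
      add = (\<lambda>A B i j. A i j \<oplus>\<^bsub>R\<^esub> B i j)\<rparr>"

definition row_module :: "('r, 'e) ring_scheme \<Rightarrow> ('r, 'i::finite \<Rightarrow> 'r) module" where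
  "row_module R =
     \<lparr>carrier = {v. \<forall>i. v i \<in> carrier R}, monoid.mult = undefined, one = undefined,
      ring.zero = (\<lambda>i. \<zero>\<^bsub>R\<^esub>), add = (\<lambda>v w i. v i \<oplus>\<^bsub>R\<^esub> w i), smult = (\<lambda>r v i. r \<otimes>\<^bsub>R\<^esub> v i)\<rparr>"

definition row_times_mat ::
  "('r, 'e) ring_scheme \<Rightarrow> ('i::finite \<Rightarrow> 'r) \<Rightarrow> ('i \<Rightarrow> 'i \<Rightarrow> 'r) \<Rightarrow> 'i \<Rightarrow> 'r" where
  "row_times_mat R v A = (\<lambda>j. \<Oplus>\<^bsub>R\<^esub>k\<in>UNIV. v k \<otimes>\<^bsub>R\<^esub> A k j)"

definition row_module_times ::
  "('r, 'e) ring_scheme \<Rightarrow> ('i::finite \<Rightarrow> 'i \<Rightarrow> 'r) \<Rightarrow> ('r, 'i \<Rightarrow> 'r) module" where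
  "row_module_times R A =
     row_module R \<lparr>carrier := {row_times_mat R v A | v. v \<in> carrier (row_module R)}\<rparr>"


section \<open>The algebra $\mathbb{C}_q[SL_2]$\<close>

text \<open>
  The free algebra on \<open>a, b, c, d\<close> is the monoid algebra of the free monoid. Words are wrapped
  lists, written additively because \<^const>\<open>Poly_Mapping.single\<close> exponents multiply that way.
\<close>

datatype gen = Gen_a | Gen_b | Gen_c | Gen_d

datatype word = Word (letters: "gen list")

instantiation word :: monoid_add
begin

definition zero_word :: word where "0 = Word []"

definition plus_word :: "word \<Rightarrow> word \<Rightarrow> word" where
  "u + v = Word (letters u @ letters v)"

instance
  by standard (auto simp: zero_word_def plus_word_def)

end

type_synonym free_alg = "word \<Rightarrow>\<^sub>0 complex"

definition free_ring :: "free_alg ring" where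
  "free_ring = \<lparr>carrier = UNIV, monoid.mult = (*), one = 1, ring.zero = 0, add = (+)\<rparr>"

definition free_const :: "complex \<Rightarrow> free_alg" where
  "free_const z = Poly_Mapping.single 0 z"

definition free_gen :: "gen \<Rightarrow> free_alg" where
  "free_gen x = Poly_Mapping.single (Word [x]) 1"

definition relators :: "complex \<Rightarrow> free_alg set" where
  "relators q =
     (let a = free_gen Gen_a; b = free_gen Gen_b; c = free_gen Gen_c; d = free_gen Gen_d in
      {b * a - free_const q * a * b,
       c * a - free_const q * a * c,
       d * b - free_const q * b * d,
       d * c - free_const q * c * d,
       b * c - c * b,
       a * d - (1 + free_const (inverse q) * b * c),
       d * a - (1 + free_const q * b * c)})"

definition rel_ideal :: "complex \<Rightarrow> free_alg set" where
  "rel_ideal q = Idl\<^bsub>free_ring\<^esub> (relators q)"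

definition CqSL2 :: "complex \<Rightarrow> free_alg set ring" where
  "CqSL2 q = free_ring Quot rel_ideal q"

definition cls :: "complex \<Rightarrow> free_alg \<Rightarrow> free_alg set" where
  "cls q p = rel_ideal q +>\<^bsub>free_ring\<^esub> p"

definition gen_cls :: "complex \<Rightarrow> gen \<Rightarrow> free_alg set" where
  "gen_cls q x = cls q (free_gen x)"

definition const_cls :: "complex \<Rightarrow> complex \<Rightarrow> free_alg set" where
  "const_cls q z = cls q (free_const z)"

definition cscale :: "complex \<Rightarrow> complex \<Rightarrow> free_alg set \<Rightarrow> free_alg set" where
  "cscale q z x = const_cls q z \<otimes>\<^bsub>CqSL2 q\<^esub> x"

definition two_q :: "complex \<Rightarrow> complex" where
  "two_q q = q + inverse q"


subsection \<open>Grading and the quantum sphere\<close>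

primrec gen_deg :: "gen \<Rightarrow> int" where
  "gen_deg Gen_a = 1"
| "gen_deg Gen_b = - 1"
| "gen_deg Gen_c = 1"
| "gen_deg Gen_d = - 1"

definition word_deg :: "word \<Rightarrow> int" where
  "word_deg w = (\<Sum>x\<leftarrow>letters w. gen_deg x)"

definition homog :: "complex \<Rightarrow> int \<Rightarrow> free_alg set set" where
  "homog q n = cls q ` {p. \<forall>w\<in>Poly_Mapping.keys p. word_deg w = n}"

definition CqS2 :: "complex \<Rightarrow> free_alg set ring" where
  "CqS2 q = CqSL2 q \<lparr>carrier := homog q 0\<rparr>"

text \<open>
  \<open>deg_twist q t\<close> is the linear map sending \<open>x\<close> to \<open>t ^ deg x * x\<close> for homogeneous \<open>x\<close>; it is
  induced from the free algebra, the relators being homogeneous.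
\<close>

definition free_deg_twist :: "complex \<Rightarrow> free_alg \<Rightarrow> free_alg" where
  "free_deg_twist t p = Poly_Mapping.mapp (\<lambda>w z. t powi word_deg w * z) p"

definition deg_twist :: "complex \<Rightarrow> complex \<Rightarrow> free_alg set \<Rightarrow> free_alg set" where
  "deg_twist q t C = the_elem ((\<lambda>p. cls q (free_deg_twist t p)) ` C)"


section \<open>The first order calculus\<close>

text \<open>
  The triple \<open>(u, v, w)\<close> is the form \<open>u e\<^sup>+ + v e\<^sup>- + w e\<^sup>0\<close>. The right action is forced by
  \<open>e\<^sup>\<plusminus> x = q ^ deg x * x e\<^sup>\<plusminus>\<close> and \<open>e\<^sup>0 x = q ^ (2 deg x) * x e\<^sup>0\<close>.
\<close>

type_synonym form = "free_alg set \<times> free_alg set \<times> free_alg set"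

definition Omega_SL2 :: "complex \<Rightarrow> (free_alg set, form) bimodule" where
  "Omega_SL2 q =
     \<lparr>carrier = carrier (CqSL2 q) \<times> carrier (CqSL2 q) \<times> carrier (CqSL2 q),
      monoid.mult = undefined, one = undefined,
      ring.zero = (\<zero>\<^bsub>CqSL2 q\<^esub>, \<zero>\<^bsub>CqSL2 q\<^esub>, \<zero>\<^bsub>CqSL2 q\<^esub>),
      add = (\<lambda>(u, v, w) (u', v', w').
        (u \<oplus>\<^bsub>CqSL2 q\<^esub> u', v \<oplus>\<^bsub>CqSL2 q\<^esub> v', w \<oplus>\<^bsub>CqSL2 q\<^esub> w')),
      smult = (\<lambda>x (u, v, w). (x \<otimes>\<^bsub>CqSL2 q\<^esub> u, x \<otimes>\<^bsub>CqSL2 q\<^esub> v, x \<otimes>\<^bsub>CqSL2 q\<^esub> w)),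
      rsmult = (\<lambda>(u, v, w) x.
        (u \<otimes>\<^bsub>CqSL2 q\<^esub> deg_twist q q x,
         v \<otimes>\<^bsub>CqSL2 q\<^esub> deg_twist q q x,
         w \<otimes>\<^bsub>CqSL2 q\<^esub> deg_twist q (q ^ 2) x))\<rparr>"

primrec gen_diff :: "complex \<Rightarrow> gen \<Rightarrow> form" where
  "gen_diff q Gen_a = (cscale q q (gen_cls q Gen_b), \<zero>\<^bsub>CqSL2 q\<^esub>, gen_cls q Gen_a)"
| "gen_diff q Gen_b =
     (\<zero>\<^bsub>CqSL2 q\<^esub>, gen_cls q Gen_a, cscale q (- inverse (q ^ 2)) (gen_cls q Gen_b))"
| "gen_diff q Gen_c = (cscale q q (gen_cls q Gen_d), \<zero>\<^bsub>CqSL2 q\<^esub>, gen_cls q Gen_c)"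
| "gen_diff q Gen_d =
     (\<zero>\<^bsub>CqSL2 q\<^esub>, gen_cls q Gen_c, cscale q (- inverse (q ^ 2)) (gen_cls q Gen_d))"

text \<open>
  The differential is the derivation extending \<^const>\<open>gen_diff\<close>: by the Leibniz rule on words,
  linearly on the free algebra, and then on classes, since it annihilates \<^const>\<open>rel_ideal\<close>.
\<close>

primrec word_diff :: "complex \<Rightarrow> gen list \<Rightarrow> form" where
  "word_diff q [] = \<zero>\<^bsub>Omega_SL2 q\<^esub>"
| "word_diff q (x # xs) =
     gen_diff q x \<triangleleft>\<^bsub>Omega_SL2 q\<^esub> cls q (Poly_Mapping.single (Word xs) 1)
       \<oplus>\<^bsub>Omega_SL2 q\<^esub> gen_cls q x \<odot>\<^bsub>Omega_SL2 q\<^esub> word_diff q xs"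

definition free_diff :: "complex \<Rightarrow> free_alg \<Rightarrow> form" where
  "free_diff q p =
     (\<Oplus>\<^bsub>Omega_SL2 q\<^esub>w\<in>Poly_Mapping.keys p.
        const_cls q (Poly_Mapping.lookup p w) \<odot>\<^bsub>Omega_SL2 q\<^esub> word_diff q (letters w))"

definition ext_diff :: "complex \<Rightarrow> free_alg set \<Rightarrow> form" where
  "ext_diff q C = the_elem (free_diff q ` C)"

text \<open>Finite sums of \<open>m dn\<close> form the complex span, scalars being absorbed into \<open>m\<close>.\<close>

definition Omega_S2 :: "complex \<Rightarrow> (free_alg set, form) bimodule" where
  "Omega_S2 q = Omega_SL2 q \<lparr>carrier := generate (add_monoid (Omega_SL2 q))
     {m \<odot>\<^bsub>Omega_SL2 q\<^esub> ext_diff q n | m n. m \<in> carrier (CqS2 q) \<and> n \<in> carrier (CqS2 q)}\<rparr>"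


section \<open>The monopole connection and the projector\<close>

datatype idx = Minus | Zero | Plus

instance idx :: finite
proof
  have "UNIV = {Minus, Zero, Plus}" by (auto intro: idx.exhaust)
  then show "finite (UNIV :: idx set)" by (metis finite.emptyI finite_insert)
qed

primrec bS2 :: "complex \<Rightarrow> idx \<Rightarrow> free_alg set" where
  "bS2 q Minus = gen_cls q Gen_a \<otimes>\<^bsub>CqSL2 q\<^esub> gen_cls q Gen_b"
| "bS2 q Zero = gen_cls q Gen_b \<otimes>\<^bsub>CqSL2 q\<^esub> gen_cls q Gen_c"
| "bS2 q Plus = gen_cls q Gen_c \<otimes>\<^bsub>CqSL2 q\<^esub> gen_cls q Gen_d"

type_synonym form2 = "(form \<times> form \<Rightarrow>\<^sub>0 int) set"

definition Omega2_S2 :: "complex \<Rightarrow> (free_alg set, form2) module" where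
  "Omega2_S2 q = tensor_product (CqS2 q) (Omega_S2 q) (Omega_S2 q)"

definition tens :: "complex \<Rightarrow> form \<Rightarrow> form \<Rightarrow> form2" where
  "tens q = pure_tensor (CqS2 q) (Omega_S2 q) (Omega_S2 q)"

definition metric_g :: "complex \<Rightarrow> form2" where
  "metric_g q =
     const_cls q (q ^ 2) \<odot>\<^bsub>Omega2_S2 q\<^esub> tens q (ext_diff q (bS2 q Minus)) (ext_diff q (bS2 q Plus))
     \<oplus>\<^bsub>Omega2_S2 q\<^esub> tens q (ext_diff q (bS2 q Plus)) (ext_diff q (bS2 q Minus))
     \<ominus>\<^bsub>Omega2_S2 q\<^esub>
       const_cls q (two_q q) \<odot>\<^bsub>Omega2_S2 q\<^esub> tens q (ext_diff q (bS2 q Zero)) (ext_diff q (bS2 q Zero))"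

definition is_connection :: "complex \<Rightarrow> (form \<Rightarrow> form2) \<Rightarrow> bool" where
  "is_connection q nabla \<longleftrightarrow>
     nabla \<in> carrier (Omega_S2 q) \<rightarrow> carrier (Omega2_S2 q) \<and>
     (\<forall>\<sigma>\<in>carrier (Omega_S2 q). \<forall>\<tau>\<in>carrier (Omega_S2 q).
        nabla (\<sigma> \<oplus>\<^bsub>Omega_S2 q\<^esub> \<tau>) = nabla \<sigma> \<oplus>\<^bsub>Omega2_S2 q\<^esub> nabla \<tau>) \<and>
     (\<forall>m\<in>carrier (CqS2 q). \<forall>\<tau>\<in>carrier (Omega_S2 q).
        nabla (m \<odot>\<^bsub>Omega_S2 q\<^esub> \<tau>)
          = tens q (ext_diff q m) \<tau> \<oplus>\<^bsub>Omega2_S2 q\<^esub> m \<odot>\<^bsub>Omega2_S2 q\<^esub> nabla \<tau>)"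

primrec E_col :: "complex \<Rightarrow> idx \<Rightarrow> free_alg set" where
  "E_col q Minus = cscale q (two_q q) (bS2 q Minus)"
| "E_col q Zero = \<one>\<^bsub>CqSL2 q\<^esub> \<oplus>\<^bsub>CqSL2 q\<^esub> cscale q (two_q q) (bS2 q Zero)"
| "E_col q Plus = cscale q (two_q q) (bS2 q Plus)"

primrec E_row :: "complex \<Rightarrow> idx \<Rightarrow> free_alg set" where
  "E_row q Minus = cscale q (- 1) (bS2 q Plus)"
| "E_row q Zero = \<one>\<^bsub>CqSL2 q\<^esub> \<oplus>\<^bsub>CqSL2 q\<^esub> cscale q (two_q q) (bS2 q Zero)"
| "E_row q Plus = cscale q (- (q ^ 2)) (bS2 q Minus)"

definition E_mat :: "complex \<Rightarrow> idx \<Rightarrow> idx \<Rightarrow> free_alg set" where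
  "E_mat q i j = E_col q i \<otimes>\<^bsub>CqSL2 q\<^esub> E_row q j"

text \<open>
  These values determine the connection, the \<open>db\<close> generating \<^const>\<open>Omega_S2\<close> as a left module.
\<close>

definition monopole_connection :: "complex \<Rightarrow> (form \<Rightarrow> form2) \<Rightarrow> bool" where
  "monopole_connection q nabla \<longleftrightarrow>
     is_connection q nabla \<and>
     nabla (ext_diff q (bS2 q Plus)) = cscale q (two_q q) (bS2 q Plus) \<odot>\<^bsub>Omega2_S2 q\<^esub> metric_g q \<and>
     nabla (ext_diff q (bS2 q Minus)) = cscale q (two_q q) (bS2 q Minus) \<odot>\<^bsub>Omega2_S2 q\<^esub> metric_g q \<and>
     nabla (ext_diff q (bS2 q Zero)) =
       (\<one>\<^bsub>CqSL2 q\<^esub> \<oplus>\<^bsub>CqSL2 q\<^esub> cscale q (two_q q) (bS2 q Zero)) \<odot>\<^bsub>Omega2_S2 q\<^esub> metric_g q"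

definition E_dE :: "complex \<Rightarrow> idx \<Rightarrow> idx \<Rightarrow> form" where
  "E_dE q i k = (\<Oplus>\<^bsub>Omega_S2 q\<^esub>j\<in>UNIV. E_mat q i j \<odot>\<^bsub>Omega_S2 q\<^esub> ext_diff q (E_mat q j k))"

end

theory Submission
  imports Defs
begin

text \<open>
  Write \<open>db\<^sub>i = G\<^sub>i\<^sup>+ e\<^sup>+ + G\<^sub>i\<^sup>- e\<^sup>-\<close>, so that \<open>G\<^sup>+ = (b\<^sup>2, q b d, d\<^sup>2)\<close> and \<open>G\<^sup>- = (a\<^sup>2, q a c, c\<^sup>2)\<close>.
  The rows \<open>H\<^sup>+ = (q\<^sup>-\<^sup>2 c\<^sup>2, -(1 + q\<^sup>-\<^sup>2) a c, a\<^sup>2)\<close> and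
  \<open>H\<^sup>- = (d\<^sup>2, -(1 + q\<^sup>2) b d, q\<^sup>2 b\<^sup>2)\<close> satisfy \<open>HG = 1\<close> and \<open>GH = 1 - E\<close>; with the column and
  row of \<open>E\<close> they form the spin one corepresentation matrix and its inverse. A degree zero element
  has no \<open>e\<^sup>0\<close> component in its differential, so the one-forms on the sphere are the
  \<open>u e\<^sup>+ + v e\<^sup>-\<close> with \<open>deg u = -2\<close> and \<open>deg v = 2\<close>, and \<open>(u, v) \<mapsto> (u, v) H\<close> inverts the frame map.
  For the connection, row times column is \<open>1\<close> and the row annihilates \<open>db\<close>, so only
  \<open>- col \<cdot> d row \<otimes> db\<close> survives of \<open>- E dE \<otimes> db\<close>, and \<open>- d row \<otimes> db\<close> is the metric.
\<close>

section \<open>Cosets of the relation ideal and their representatives\<close>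

section \<open>Classes in $\mathbb{C}_q[SL_2]$\<close>

lemma ring_free_ring: "ring free_ring"
proof (rule ringI)
  show "abelian_group free_ring"
  proof (rule abelian_groupI)
    fix x assume "x \<in> carrier free_ring"
    show "\<exists>y\<in>carrier free_ring. y \<oplus>\<^bsub>free_ring\<^esub> x = \<zero>\<^bsub>free_ring\<^esub>"
      by (rule bexI[of _ "- x"]) (simp_all add: free_ring_def)
  qed (simp_all add: free_ring_def algebra_simps)
  show "Group.monoid free_ring"
    by (rule monoidI) (simp_all add: free_ring_def algebra_simps)
qed (simp_all add: free_ring_def algebra_simps)

interpretation free_ring: ring free_ring
  by (rule ring_free_ring)

lemma free_ring_simps [simp]:
  "carrier free_ring = UNIV" "x \<otimes>\<^bsub>free_ring\<^esub> y = x * y" "x \<oplus>\<^bsub>free_ring\<^esub> y = x + y"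
  "\<one>\<^bsub>free_ring\<^esub> = 1" "\<zero>\<^bsub>free_ring\<^esub> = 0"
  by (simp_all add: free_ring_def)

lemma a_inv_free_ring [simp]: "\<ominus>\<^bsub>free_ring\<^esub> x = - x"
  by (rule free_ring.minus_equality) simp_all

lemma ideal_rel_ideal: "ideal (rel_ideal q) free_ring"
  unfolding rel_ideal_def by (rule free_ring.genideal_ideal) simp

lemma rel_ideal_0 [simp]: "0 \<in> rel_ideal q"
  using additive_subgroup.zero_closed[OF ideal.axioms(1)[OF ideal_rel_ideal]] by simp

lemma rel_ideal_add: "x \<in> rel_ideal q \<Longrightarrow> y \<in> rel_ideal q \<Longrightarrow> x + y \<in> rel_ideal q"
  using additive_subgroup.a_closed[OF ideal.axioms(1)[OF ideal_rel_ideal]] by simp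

lemma rel_ideal_uminus: "x \<in> rel_ideal q \<Longrightarrow> - x \<in> rel_ideal q"
  using additive_subgroup.a_inv_closed[OF ideal.axioms(1)[OF ideal_rel_ideal]] by simp

lemma rel_ideal_mult:
  assumes "x \<in> rel_ideal q"
  shows "y * x \<in> rel_ideal q" "x * y \<in> rel_ideal q"
  using ideal.I_l_closed[OF ideal_rel_ideal assms, of y] ideal.I_r_closed[OF ideal_rel_ideal assms, of y]
  by simp_all

lemma relators_subset_rel_ideal: "relators q \<subseteq> rel_ideal q"
  unfolding rel_ideal_def by (rule free_ring.genideal_self) simp

text \<open>The members of the ideal that satisfy \<open>P\<close> form an ideal containing the
  relators, hence all of it by minimality. Membership is carried along so that each case may use
  it.\<close>

lemma rel_ideal_induct [consumes 1, case_names relator add uminus mult]: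
  assumes "x \<in> rel_ideal q"
    and relator: "\<And>r. r \<in> relators q \<Longrightarrow> P r"
    and add: "\<And>x y. x \<in> rel_ideal q \<Longrightarrow> y \<in> rel_ideal q \<Longrightarrow> P x \<Longrightarrow> P y \<Longrightarrow> P (x + y)"
    and uminus: "\<And>x. x \<in> rel_ideal q \<Longrightarrow> P x \<Longrightarrow> P (- x)"
    and mult: "\<And>x y. x \<in> rel_ideal q \<Longrightarrow> P x \<Longrightarrow> P (y * x) \<and> P (x * y)"
  shows "P x"
proof -
  have rel: "r \<in> rel_ideal q" if "r \<in> relators q" for r
    using that relators_subset_rel_ideal by blast
  \<comment> \<open>Any relator serves: multiplying it by 0 yields \<open>P 0\<close>, for which
    there is no separate case.\<close>
  obtain r where r: "r \<in> relators q"
    by (auto simp: relators_def Let_def)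
  have "P (0 * r)"
    using mult[OF rel[OF r] relator[OF r]] by blast
  then have P0: "P 0"
    by simp
  have "ideal {x \<in> rel_ideal q. P x} free_ring"
  proof (rule idealI[OF ring_free_ring])
    show "subgroup {x \<in> rel_ideal q. P x} (add_monoid free_ring)"
    proof (rule group.subgroupI)
      show "group (add_monoid free_ring)"
        by (rule free_ring.a_group)
      show "{x \<in> rel_ideal q. P x} \<noteq> {}"
        using P0 by (auto intro: rel_ideal_0)
      show "inv\<^bsub>add_monoid free_ring\<^esub> x \<in> {x \<in> rel_ideal q. P x}"
        if "x \<in> {x \<in> rel_ideal q. P x}" for x
        using that uminus rel_ideal_uminus by (auto simp only: a_inv_free_ring[unfolded a_inv_def])
    qed (auto intro: add rel_ideal_add)
  qed (use mult rel_ideal_mult in auto)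
  moreover have "relators q \<subseteq> {x \<in> rel_ideal q. P x}"
    using relator rel by auto
  ultimately have "Idl\<^bsub>free_ring\<^esub> (relators q) \<subseteq> {x \<in> rel_ideal q. P x}"
    by (rule free_ring.genideal_minimal)
  then show ?thesis
    using assms(1) by (auto simp: rel_ideal_def)
qed

lemma cls_eq_image: "cls q p = (\<lambda>r. r + p) ` rel_ideal q"
  by (auto simp: cls_def a_r_coset_def')

lemma in_cls_iff: "p' \<in> cls q p \<longleftrightarrow> p' - p \<in> rel_ideal q"
  unfolding cls_eq_image by (auto simp: image_iff algebra_simps intro: bexI[of _ "p' - p"])

lemma self_in_cls [simp]: "p \<in> cls q p"
  by (simp add: in_cls_iff)

lemma cls_eq_iff: "cls q p = cls q p' \<longleftrightarrow> p - p' \<in> rel_ideal q"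
proof
  assume "cls q p = cls q p'"
  then show "p - p' \<in> rel_ideal q"
    using self_in_cls[of p q] by (simp add: in_cls_iff)
next
  assume *: "p - p' \<in> rel_ideal q"
  show "cls q p = cls q p'"
  proof (intro Set.set_eqI iffI)
    show "x \<in> cls q p'" if "x \<in> cls q p" for x
      using rel_ideal_add[OF that[unfolded in_cls_iff] *] by (simp add: in_cls_iff)
    show "x \<in> cls q p" if "x \<in> cls q p'" for x
      using rel_ideal_add[OF that[unfolded in_cls_iff] rel_ideal_uminus[OF *]] by (simp add: in_cls_iff)
  qed
qed

text \<open>\<open>deg_twist\<close> and \<open>ext_diff\<close> are defined as the only value taken
  on a coset. Once constancy modulo the ideal is known, this evaluates them on a
  representative.\<close>

lemma the_elem_image_cls:
  assumes "\<And>x y. x - y \<in> rel_ideal q \<Longrightarrow> f x = f y"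
  shows "the_elem (f ` cls q p) = f p"
proof -
  have "f ` cls q p = {f p}"
  proof
    show "f ` cls q p \<subseteq> {f p}"
      using assms[of _ p] unfolding in_cls_iff[symmetric] by blast
    show "{f p} \<subseteq> f ` cls q p"
      by simp
  qed
  then show ?thesis by simp
qed

interpretation CqSL2: ring "CqSL2 q" for q
  unfolding CqSL2_def by (rule ideal.quotient_is_ring[OF ideal_rel_ideal])

lemma carrier_CqSL2: "carrier (CqSL2 q) = range (cls q)"
  by (auto simp: CqSL2_def FactRing_def A_RCOSETS_def' cls_def)

lemma cls_in_carrier [simp]: "cls q p \<in> carrier (CqSL2 q)"
  by (simp add: carrier_CqSL2)

lemma cls_ops [simp]:
  "cls q p \<otimes>\<^bsub>CqSL2 q\<^esub> cls q p' = cls q (p * p')"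
  "cls q p \<oplus>\<^bsub>CqSL2 q\<^esub> cls q p' = cls q (p + p')"
  using ring_hom_mult[OF ideal.rcos_ring_hom[OF ideal_rel_ideal], of p p' q]
    ring_hom_add[OF ideal.rcos_ring_hom[OF ideal_rel_ideal], of p p' q]
  by (simp_all add: CqSL2_def cls_def)

lemma one_CqSL2: "\<one>\<^bsub>CqSL2 q\<^esub> = cls q 1"
  using ring_hom_one[OF ideal.rcos_ring_hom[OF ideal_rel_ideal], of q]
  by (simp add: CqSL2_def cls_def)

lemma zero_CqSL2: "\<zero>\<^bsub>CqSL2 q\<^esub> = cls q 0"
  by (simp add: CqSL2_def FactRing_def cls_eq_image)

lemma a_inv_cls: "\<ominus>\<^bsub>CqSL2 q\<^esub> cls q p = cls q (- p)"
  by (rule CqSL2.minus_equality) (simp_all add: zero_CqSL2)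

lemma cls_mult_cong: "cls q p = cls q p' \<Longrightarrow> cls q r = cls q r' \<Longrightarrow> cls q (p * r) = cls q (p' * r')"
  by (metis cls_ops(1))

lemma cls_add_cong: "cls q p = cls q p' \<Longrightarrow> cls q r = cls q r' \<Longrightarrow> cls q (p + r) = cls q (p' + r')"
  by (metis cls_ops(2))

lemma cls_relator: "x - y \<in> relators q \<Longrightarrow> cls q x = cls q y"
  using relators_subset_rel_ideal by (auto simp: cls_eq_iff)

section \<open>Rewriting in an abstract ring with the given relations\<close>

section \<open>Normal ordering of monomials\<close>

text \<open>\<open>K\<close> and \<open>L\<close> stand for \<open>q\<close> and its inverse as
  central ring elements, so that scalars and letters are reordered by the same rewriting.\<close>

locale sl2_relations = ring +
  fixes K L a b c d
  assumes closed [simp]: "K \<in> carrier R" "L \<in> carrier R"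
      "a \<in> carrier R" "b \<in> carrier R" "c \<in> carrier R" "d \<in> carrier R"
    and KL: "K \<otimes> L = \<one>" "L \<otimes> K = \<one>"
    and central: "a \<otimes> K = K \<otimes> a" "b \<otimes> K = K \<otimes> b" "c \<otimes> K = K \<otimes> c" "d \<otimes> K = K \<otimes> d"
      "a \<otimes> L = L \<otimes> a" "b \<otimes> L = L \<otimes> b" "c \<otimes> L = L \<otimes> c" "d \<otimes> L = L \<otimes> d"
    and ba: "b \<otimes> a = K \<otimes> (a \<otimes> b)" and ca: "c \<otimes> a = K \<otimes> (a \<otimes> c)"
    and db: "d \<otimes> b = K \<otimes> (b \<otimes> d)" and dc: "d \<otimes> c = K \<otimes> (c \<otimes> d)"
    and bc: "b \<otimes> c = c \<otimes> b"
    and ad: "a \<otimes> d = \<one> \<oplus> L \<otimes> (b \<otimes> c)" and da: "d \<otimes> a = \<one> \<oplus> K \<otimes> (b \<otimes> c)"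
begin

text \<open>Lets a rule for two adjacent letters fire inside a right-nested word, where the pair is
  not a subterm.\<close>

lemma mult_left_cong:
  assumes "x \<otimes> y = z" "x \<in> carrier R" "y \<in> carrier R" "w \<in> carrier R"
  shows "x \<otimes> (y \<otimes> w) = z \<otimes> w"
  using assms m_assoc by metis

text \<open>The relation is turned around so that \<open>a\<close> travels right past
  \<open>b\<close>. With \<open>ac\<close>, \<open>db\<close> and \<open>dc\<close>, every
  \<open>a\<close> and \<open>d\<close> ends up to the right of \<open>b\<close> and
  \<open>c\<close>, where \<open>ad\<close> and \<open>da\<close> eliminate mixed pairs.\<close>

lemma ab: "a \<otimes> b = L \<otimes> (b \<otimes> a)"
  by (simp add: ba m_assoc[symmetric] KL)

lemma ac: "a \<otimes> c = L \<otimes> (c \<otimes> a)"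
  by (simp add: ca m_assoc[symmetric] KL)

text \<open>Rewriting with these rules brings every monomial to the form \<open>K\<^sup>i b\<^sup>j c\<^sup>k a\<^sup>l\<close> or
  \<open>K\<^sup>i b\<^sup>j c\<^sup>k d\<^sup>l\<close>, with \<open>L\<close> for negative powers of \<open>K\<close>.\<close>
lemmas letter_rules = KL central ab ac db dc bc[symmetric] ad da

lemmas word_rules = letter_rules letter_rules[THEN mult_left_cong]

lemmas normal_form = word_rules m_assoc l_distr r_distr a_ac

text \<open>Row times column of \<open>E\<close> is 1. Here and in the next identities the negative
  terms are moved to the other side, so that \<open>normal_form\<close> compares sums of
  monomials.\<close>

lemma row_col_pos:
  "(\<one> \<oplus> (K \<oplus> L) \<otimes> (b \<otimes> c)) \<otimes> (\<one> \<oplus> (K \<oplus> L) \<otimes> (b \<otimes> c)) =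
   \<one> \<oplus> c \<otimes> d \<otimes> ((K \<oplus> L) \<otimes> (a \<otimes> b)) \<oplus> K \<otimes> K \<otimes> (a \<otimes> b) \<otimes> ((K \<oplus> L) \<otimes> (c \<otimes> d))"
  by (simp add: normal_form)

text \<open>The row of \<open>E\<close> annihilates both columns of \<open>G\<close>.\<close>

lemma row_G_pos:
  "(\<one> \<oplus> (K \<oplus> L) \<otimes> (b \<otimes> c)) \<otimes> (K \<otimes> (b \<otimes> d)) =
    c \<otimes> d \<otimes> (b \<otimes> b) \<oplus> K \<otimes> K \<otimes> (a \<otimes> b) \<otimes> (d \<otimes> d)"
  "(\<one> \<oplus> (K \<oplus> L) \<otimes> (b \<otimes> c)) \<otimes> (K \<otimes> (a \<otimes> c)) =
    c \<otimes> d \<otimes> (a \<otimes> a) \<oplus> K \<otimes> K \<otimes> (a \<otimes> b) \<otimes> (c \<otimes> c)"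
  by (simp_all add: normal_form)

text \<open>The \<open>Minus\<close> row of \<open>GH = 1 - E\<close>, one entry per equation; the
  middle equation is negated.\<close>

lemma GH_minus_pos:
  "b \<otimes> b \<otimes> (L \<otimes> L \<otimes> (c \<otimes> c)) \<oplus> a \<otimes> a \<otimes> (d \<otimes> d) = \<one> \<oplus> (K \<oplus> L) \<otimes> (a \<otimes> b) \<otimes> (c \<otimes> d)"
  "b \<otimes> b \<otimes> ((\<one> \<oplus> L \<otimes> L) \<otimes> (a \<otimes> c)) \<oplus> a \<otimes> a \<otimes> ((\<one> \<oplus> K \<otimes> K) \<otimes> (b \<otimes> d)) =
    (K \<oplus> L) \<otimes> (a \<otimes> b) \<otimes> (\<one> \<oplus> (K \<oplus> L) \<otimes> (b \<otimes> c))"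
  "b \<otimes> b \<otimes> (a \<otimes> a) \<oplus> a \<otimes> a \<otimes> (K \<otimes> K \<otimes> (b \<otimes> b)) =
    (K \<oplus> L) \<otimes> (a \<otimes> b) \<otimes> (K \<otimes> K \<otimes> (a \<otimes> b))"
  by (simp_all add: normal_form)

text \<open>The \<open>Zero\<close> row of \<open>GH = 1 - E\<close>. In the middle equation the
  diagonal 1 moves to the left, because the entries of \<open>H\<close> in that column carry a minus
  sign.\<close>

lemma GH_zero_pos:
  "K \<otimes> (b \<otimes> d) \<otimes> (L \<otimes> L \<otimes> (c \<otimes> c)) \<oplus> K \<otimes> (a \<otimes> c) \<otimes> (d \<otimes> d) =
    (\<one> \<oplus> (K \<oplus> L) \<otimes> (b \<otimes> c)) \<otimes> (c \<otimes> d)"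
  "K \<otimes> (b \<otimes> d) \<otimes> ((\<one> \<oplus> L \<otimes> L) \<otimes> (a \<otimes> c)) \<oplus> K \<otimes> (a \<otimes> c) \<otimes> ((\<one> \<oplus> K \<otimes> K) \<otimes> (b \<otimes> d)) \<oplus> \<one> =
    (\<one> \<oplus> (K \<oplus> L) \<otimes> (b \<otimes> c)) \<otimes> (\<one> \<oplus> (K \<oplus> L) \<otimes> (b \<otimes> c))"
  "K \<otimes> (b \<otimes> d) \<otimes> (a \<otimes> a) \<oplus> K \<otimes> (a \<otimes> c) \<otimes> (K \<otimes> K \<otimes> (b \<otimes> b)) =
    (\<one> \<oplus> (K \<oplus> L) \<otimes> (b \<otimes> c)) \<otimes> (K \<otimes> K \<otimes> (a \<otimes> b))"
  by (simp_all add: normal_form)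

lemma GH_plus_pos:
  "d \<otimes> d \<otimes> (L \<otimes> L \<otimes> (c \<otimes> c)) \<oplus> c \<otimes> c \<otimes> (d \<otimes> d) = (K \<oplus> L) \<otimes> (c \<otimes> d) \<otimes> (c \<otimes> d)"
  "d \<otimes> d \<otimes> ((\<one> \<oplus> L \<otimes> L) \<otimes> (a \<otimes> c)) \<oplus> c \<otimes> c \<otimes> ((\<one> \<oplus> K \<otimes> K) \<otimes> (b \<otimes> d)) =
    (K \<oplus> L) \<otimes> (c \<otimes> d) \<otimes> (\<one> \<oplus> (K \<oplus> L) \<otimes> (b \<otimes> c))"
  "d \<otimes> d \<otimes> (a \<otimes> a) \<oplus> c \<otimes> c \<otimes> (K \<otimes> K \<otimes> (b \<otimes> b)) =
    \<one> \<oplus> (K \<oplus> L) \<otimes> (c \<otimes> d) \<otimes> (K \<otimes> K \<otimes> (a \<otimes> b))"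
  by (simp_all add: normal_form)

text \<open>The four entries of \<open>HG = 1\<close>, with the negative \<open>Zero\<close> summand
  moved to the right.\<close>

lemma HG_pos:
  "L \<otimes> L \<otimes> (c \<otimes> c) \<otimes> (b \<otimes> b) \<oplus> a \<otimes> a \<otimes> (d \<otimes> d) =
    \<one> \<oplus> (\<one> \<oplus> L \<otimes> L) \<otimes> (a \<otimes> c) \<otimes> (K \<otimes> (b \<otimes> d))"
  "L \<otimes> L \<otimes> (c \<otimes> c) \<otimes> (a \<otimes> a) \<oplus> a \<otimes> a \<otimes> (c \<otimes> c) =
    (\<one> \<oplus> L \<otimes> L) \<otimes> (a \<otimes> c) \<otimes> (K \<otimes> (a \<otimes> c))"
  "d \<otimes> d \<otimes> (b \<otimes> b) \<oplus> K \<otimes> K \<otimes> (b \<otimes> b) \<otimes> (d \<otimes> d) =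
    (\<one> \<oplus> K \<otimes> K) \<otimes> (b \<otimes> d) \<otimes> (K \<otimes> (b \<otimes> d))"
  "d \<otimes> d \<otimes> (a \<otimes> a) \<oplus> K \<otimes> K \<otimes> (b \<otimes> b) \<otimes> (c \<otimes> c) =
    \<one> \<oplus> (\<one> \<oplus> K \<otimes> K) \<otimes> (b \<otimes> d) \<otimes> (K \<otimes> (a \<otimes> c))"
  by (simp_all add: normal_form)

end

section \<open>Linear maps on the free algebra that descend to the quotient\<close>

section \<open>Degree twists and twisted derivations\<close>

lemma free_alg_induct [case_names single add]:
  fixes p :: free_alg
  assumes single: "\<And>w z. P (Poly_Mapping.single w z)"
    and add: "\<And>x y. P x \<Longrightarrow> P y \<Longrightarrow> P (x + y)"
  shows "P p"
proof -
  have "P (\<Sum>w\<in>A. Poly_Mapping.single w (Poly_Mapping.lookup p w))" if "finite A" for A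
    using that
  proof induction
    case empty
    then show ?case
      using single[of 0 0] by simp
  qed (simp add: single add)
  moreover have "(\<Sum>w\<in>Poly_Mapping.keys p. Poly_Mapping.single w (Poly_Mapping.lookup p w)) = p"
    by (rule poly_mapping_eqI)
      (auto simp: lookup_sum lookup_single when_def in_keys_iff sum.delta)
  ultimately show ?thesis
    by (metis finite_keys)
qed

text \<open>Scalars act through multiplication by \<open>free_const\<close>. The twist and the
  derivations below are both instances, so additivity is proved once.\<close>

definition linear_ext :: "(word \<Rightarrow> free_alg) \<Rightarrow> free_alg \<Rightarrow> free_alg" where
  "linear_ext f p =
     (\<Sum>w\<in>Poly_Mapping.keys p. free_const (Poly_Mapping.lookup p w) * f w)"

lemma free_const_0 [simp]: "free_const 0 = 0"
  and free_const_1 [simp]: "free_const 1 = 1"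
  and free_const_add: "free_const (x + y) = free_const x + free_const y"
  and free_const_uminus: "free_const (- x) = - free_const x"
  and free_const_mult: "free_const (x * y) = free_const x * free_const y"
  by (simp_all add: free_const_def single_add single_uminus mult_single)

lemma free_const_commute: "p * free_const z = free_const z * p"
  by (induction p rule: free_alg_induct)
    (simp_all add: free_const_def mult_single ring_distribs mult.commute)

lemma free_const_left_commute: "p * (free_const z * r) = free_const z * (p * r)"
  by (metis free_const_commute mult.assoc)

lemma single_eq_const_mult: "Poly_Mapping.single w z = free_const z * Poly_Mapping.single w 1"
  by (simp add: free_const_def mult_single)

lemma single_Word_Cons:
  "Poly_Mapping.single (Word (x # xs)) 1 = free_gen x * Poly_Mapping.single (Word xs) 1"
  by (simp add: free_gen_def mult_single plus_word_def)

lemma single_Word_append: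
  "Poly_Mapping.single (Word (xs @ ys)) (1::complex)
     = Poly_Mapping.single (Word xs) 1 * Poly_Mapping.single (Word ys) 1"
  by (simp add: mult_single plus_word_def)

lemma single_Word_Nil [simp]: "Poly_Mapping.single (Word []) (1::complex) = 1"
  by (simp flip: zero_word_def)

lemma linear_ext_add: "linear_ext f (p + r) = linear_ext f p + linear_ext f r"
  unfolding linear_ext_def
  by (rule setsum_keys_plus_distrib) (simp_all add: free_const_add ring_distribs)

lemma linear_ext_single: "linear_ext f (Poly_Mapping.single w z) = free_const z * f w"
  by (simp add: linear_ext_def)

lemma linear_ext_0 [simp]: "linear_ext f 0 = 0"
  by (simp add: linear_ext_def)

lemma linear_ext_uminus: "linear_ext f (- p) = - linear_ext f p"
  using linear_ext_add[of f p "- p"] by (simp add: eq_neg_iff_add_eq_0 add.commute)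

section \<open>The degree grading of the free algebra\<close>

lemma word_deg_simps [simp]:
  "word_deg (Word []) = 0" "word_deg 0 = 0"
  "word_deg (Word (x # xs)) = gen_deg x + word_deg (Word xs)"
  "word_deg (u + v) = word_deg u + word_deg v"
  by (simp_all add: word_deg_def plus_word_def zero_word_def)

definition free_homog :: "int \<Rightarrow> free_alg set" where
  "free_homog n = {p. \<forall>w\<in>Poly_Mapping.keys p. word_deg w = n}"

lemma homog_eq: "homog q n = cls q ` free_homog n"
  by (simp add: homog_def free_homog_def)

lemma free_homog_single: "word_deg w = n \<Longrightarrow> Poly_Mapping.single w z \<in> free_homog n"
  by (simp add: free_homog_def)

lemma free_homog_0 [simp]: "0 \<in> free_homog n"
  and free_homog_1 [simp]: "1 \<in> free_homog 0"
  and free_homog_const [simp]: "free_const z \<in> free_homog 0"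
  and free_homog_gen: "free_gen x \<in> free_homog (gen_deg x)"
  by (simp_all add: free_homog_def free_const_def free_gen_def)

lemma free_homog_add: "p \<in> free_homog n \<Longrightarrow> r \<in> free_homog n \<Longrightarrow> p + r \<in> free_homog n"
  using Poly_Mapping.keys_add[of p r] by (auto simp: free_homog_def)

lemma free_homog_uminus: "p \<in> free_homog n \<Longrightarrow> - p \<in> free_homog n"
  by (simp add: free_homog_def in_keys_iff)

lemma free_homog_diff: "p \<in> free_homog n \<Longrightarrow> r \<in> free_homog n \<Longrightarrow> p - r \<in> free_homog n"
  using free_homog_add[OF _ free_homog_uminus, of p n r] by simp

lemma free_homog_mult:
  "p \<in> free_homog m \<Longrightarrow> r \<in> free_homog n \<Longrightarrow> m + n = k \<Longrightarrow> p * r \<in> free_homog k"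
  using Poly_Mapping.keys_mult[of p r] by (fastforce simp: free_homog_def)

lemma free_homog_const_mult: "p \<in> free_homog n \<Longrightarrow> free_const z * p \<in> free_homog n"
  by (rule free_homog_mult[of _ 0 _ n]) simp_all

lemma free_homog_sum: "(\<And>x. x \<in> A \<Longrightarrow> f x \<in> free_homog n) \<Longrightarrow> sum f A \<in> free_homog n"
  by (induction A rule: infinite_finite_induct) (simp_all add: free_homog_add)

lemma linear_ext_free_homog:
  assumes "p \<in> free_homog n" "\<And>w. word_deg w = n \<Longrightarrow> f w \<in> free_homog m"
  shows "linear_ext f p \<in> free_homog m"
  unfolding linear_ext_def
  using assms by (intro free_homog_sum free_homog_const_mult) (auto simp: free_homog_def)

text \<open>This describes both the twist and the \<open>e\<^sup>0\<close> coordinate of the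
  differential on homogeneous elements: each scales all words of one degree by a common
  factor.\<close>

lemma linear_ext_scalar:
  assumes "p \<in> free_homog n"
    and "\<And>w. word_deg w = n \<Longrightarrow> f w = free_const z * Poly_Mapping.single w 1"
  shows "linear_ext f p = free_const z * p"
proof -
  have "linear_ext f p = linear_ext (\<lambda>w. free_const z * Poly_Mapping.single w 1) p"
    unfolding linear_ext_def using assms by (intro sum.cong) (auto simp: free_homog_def)
  also have "\<dots> = free_const z * p"
    by (induction p rule: free_alg_induct)
      (simp_all add: linear_ext_add linear_ext_single ring_distribs free_const_def mult_single mult.commute)
  finally show ?thesis .
qed

text \<open>The relators for \<open>c a\<close> and \<open>d b\<close> have degrees 2 and -2, the
  others degree 0. Hence a map acting as a scalar in each degree sends relators into the
  ideal.\<close>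

lemma relators_homog:
  assumes "r \<in> relators q"
  shows "\<exists>n. r \<in> free_homog n"
proof -
  have gens: "free_gen x * free_gen y \<in> free_homog n"
    "free_const z * free_gen x * free_gen y \<in> free_homog n"
    if "gen_deg x + gen_deg y = n" for x y z n
    using that free_homog_mult[OF free_homog_gen free_homog_gen that] free_homog_const_mult
    by (simp_all add: mult.assoc)
  have "r \<in> free_homog 0 \<or> r \<in> free_homog 2 \<or> r \<in> free_homog (- 2)"
    using assms unfolding relators_def Let_def
    by (elim insertE emptyE; simp add: free_homog_diff free_homog_add gens)
  then show ?thesis
    by blast
qed

section \<open>Degree twists\<close>

lemma free_deg_twist_eq:
  "free_deg_twist t = linear_ext (\<lambda>w. free_const (t powi word_deg w) * Poly_Mapping.single w 1)"
proof
  fix p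
  show "free_deg_twist t p = linear_ext (\<lambda>w. free_const (t powi word_deg w) * Poly_Mapping.single w 1) p"
    by (rule poly_mapping_eqI)
      (auto simp: free_deg_twist_def linear_ext_def lookup_mapp lookup_sum lookup_single when_def
         in_keys_iff free_const_def mult_single sum.delta mult.commute)
qed

lemma free_deg_twist_simps [simp]:
  "free_deg_twist t (p + r) = free_deg_twist t p + free_deg_twist t r"
  "free_deg_twist t 0 = 0" "free_deg_twist t (- p) = - free_deg_twist t p"
  by (simp_all add: free_deg_twist_eq linear_ext_add linear_ext_uminus)

lemma free_deg_twist_homog: "p \<in> free_homog n \<Longrightarrow> free_deg_twist t p = free_const (t powi n) * p"
  unfolding free_deg_twist_eq by (rule linear_ext_scalar) auto

text \<open>Degrees add under concatenation of words, and \<open>t \<noteq> 0\<close> makes the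
  integer power turn this sum into a product.\<close>

lemma free_deg_twist_mult:
  assumes "t \<noteq> 0"
  shows "free_deg_twist t (p * r) = free_deg_twist t p * free_deg_twist t r"
proof (induction p rule: free_alg_induct)
  case (single w z)
  show ?case
  proof (induction r rule: free_alg_induct)
    case (single w' z')
    show ?case
      using assms
      by (simp add: free_deg_twist_eq linear_ext_single mult_single free_const_def power_int_add mult_ac)
  qed (simp add: ring_distribs)
qed (simp add: ring_distribs)

text \<open>On a homogeneous relator the twist is a scalar; multiplicativity carries the claim
  through the ideal.\<close>

lemma free_deg_twist_rel_ideal:
  assumes "t \<noteq> 0" "x \<in> rel_ideal q"
  shows "free_deg_twist t x \<in> rel_ideal q"
  using assms(2)
proof (induction rule: rel_ideal_induct)
  case (relator r)
  then show ?case
    using relators_homog[OF relator] relators_subset_rel_ideal[of q]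
    by (auto simp: free_deg_twist_homog intro!: rel_ideal_mult(1))
qed (use assms(1) in \<open>auto simp: free_deg_twist_mult rel_ideal_add rel_ideal_uminus rel_ideal_mult\<close>)

lemma deg_twist_cls:
  assumes "t \<noteq> 0"
  shows "deg_twist q t (cls q p) = cls q (free_deg_twist t p)"
  unfolding deg_twist_def
proof (rule the_elem_image_cls)
  fix x y assume "x - y \<in> rel_ideal q"
  from free_deg_twist_rel_ideal[OF assms this]
  show "cls q (free_deg_twist t x) = cls q (free_deg_twist t y)"
    \<comment> \<open>The difference is written as a sum with a negative, since the twist rules
      cover addition and negation.\<close>
    by (simp add: cls_eq_iff diff_conv_add_uminus del: add_uminus_conv_diff)
qed

section \<open>Twisted derivations\<close>

primrec word_der :: "complex \<Rightarrow> (gen \<Rightarrow> free_alg) \<Rightarrow> gen list \<Rightarrow> free_alg" where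
  "word_der t \<delta> [] = 0"
| "word_der t \<delta> (x # xs) =
     \<delta> x * free_deg_twist t (Poly_Mapping.single (Word xs) 1) + free_gen x * word_der t \<delta> xs"

text \<open>The coefficient of one basis form \<open>e\<close> in the differential: if
  \<open>e y = tw(y) e\<close>, the Leibniz rule for \<open>d\<close> becomes
  \<open>D (x y) = D x tw(y) + x D y\<close>.\<close>

definition twisted_der :: "complex \<Rightarrow> (gen \<Rightarrow> free_alg) \<Rightarrow> free_alg \<Rightarrow> free_alg" where
  "twisted_der t \<delta> = linear_ext (\<lambda>w. word_der t \<delta> (letters w))"

lemma free_deg_twist_const [simp]: "free_deg_twist t (free_const z) = free_const z"
  using free_deg_twist_homog[OF free_homog_const, of t z] by simp

lemma free_deg_twist_1 [simp]: "free_deg_twist t 1 = 1"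
  using free_deg_twist_const[of t 1] by simp

lemma free_deg_twist_gen: "free_deg_twist t (free_gen x) = free_const (t powi gen_deg x) * free_gen x"
  by (rule free_deg_twist_homog[OF free_homog_gen])

lemma twisted_der_add [simp]: "twisted_der t \<delta> (p + r) = twisted_der t \<delta> p + twisted_der t \<delta> r"
  and twisted_der_0 [simp]: "twisted_der t \<delta> 0 = 0"
  and twisted_der_uminus [simp]: "twisted_der t \<delta> (- p) = - twisted_der t \<delta> p"
  by (simp_all add: twisted_der_def linear_ext_add linear_ext_uminus)

lemma twisted_der_diff [simp]: "twisted_der t \<delta> (p - r) = twisted_der t \<delta> p - twisted_der t \<delta> r"
  using twisted_der_add[of t \<delta> p "- r"] by simp

lemma twisted_der_const [simp]: "twisted_der t \<delta> (free_const z) = 0"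
  by (simp add: twisted_der_def free_const_def linear_ext_single zero_word_def)

lemma twisted_der_1 [simp]: "twisted_der t \<delta> 1 = 0"
  using twisted_der_const[of t \<delta> 1] by simp

lemma twisted_der_gen [simp]: "twisted_der t \<delta> (free_gen x) = \<delta> x"
  by (simp add: twisted_der_def free_gen_def linear_ext_single)

lemma word_der_append:
  assumes "t \<noteq> 0"
  shows "word_der t \<delta> (xs @ ys) =
    word_der t \<delta> xs * free_deg_twist t (Poly_Mapping.single (Word ys) 1)
    + Poly_Mapping.single (Word xs) 1 * word_der t \<delta> ys"
  by (induction xs)
    (simp_all add: single_Word_append single_Word_Cons free_deg_twist_mult[OF assms] algebra_simps)

text \<open>Bilinearity reduces the twisted Leibniz rule to two words, where it is
  \<open>word_der_append\<close>.\<close>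

lemma twisted_der_mult:
  assumes "t \<noteq> 0"
  shows "twisted_der t \<delta> (p * r) = twisted_der t \<delta> p * free_deg_twist t r + p * twisted_der t \<delta> r"
proof (induction p rule: free_alg_induct)
  case (single w z)
  show ?case
  proof (induction r rule: free_alg_induct)
    case (single w' z')
    obtain xs ys where w: "w = Word xs" "w' = Word ys"
      by (metis word.collapse)
    have tw: "free_deg_twist t (Poly_Mapping.single (Word ys) z') =
      free_const z' * free_deg_twist t (Poly_Mapping.single (Word ys) 1)"
      by (simp add: free_deg_twist_eq linear_ext_single)
    show ?case
      unfolding w mult_single twisted_der_def linear_ext_single tw
      by (simp add: plus_word_def word_der_append[OF assms] free_const_mult ring_distribs mult.assoc
        single_eq_const_mult[of _ z] free_const_left_commute[of "word_der t \<delta> xs"]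
        free_const_left_commute[of "Poly_Mapping.single (Word xs) 1"])
  qed (simp add: algebra_simps)
qed (simp add: algebra_simps)

text \<open>The twist preserves degrees, so a degree shift \<open>s\<close> on the generators
  propagates to all words. It is applied with \<open>s = -2\<close> to the \<open>e\<^sup>+\<close>
  coordinate and with \<open>s = 2\<close> to the \<open>e\<^sup>-\<close> coordinate.\<close>

lemma twisted_der_homog:
  assumes "\<And>x. \<delta> x \<in> free_homog (gen_deg x + s)" "p \<in> free_homog n"
  shows "twisted_der t \<delta> p \<in> free_homog (n + s)"
  unfolding twisted_der_def
proof (rule linear_ext_free_homog[OF assms(2)])
  have *: "word_der t \<delta> xs \<in> free_homog (word_deg (Word xs) + s)" for xs
  proof (induction xs)
    case (Cons x xs)
    have "Poly_Mapping.single (Word xs) 1 \<in> free_homog (word_deg (Word xs))"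
      by (simp add: free_homog_single)
    with Cons show ?case
      by (auto simp: free_deg_twist_homog
        intro!: free_homog_add free_homog_mult[OF assms(1)] free_homog_mult[OF free_homog_gen]
          free_homog_const_mult free_homog_single)
  qed simp
  show "word_der t \<delta> (letters w) \<in> free_homog (n + s)" if "word_deg w = n" for w
    using *[of "letters w"] that by simp
qed

text \<open>By the twisted Leibniz rule the relators suffice: a product with an ideal element
  produces its derivative and its twist, and both stay in the ideal.\<close>

lemma twisted_der_rel_ideal:
  assumes "t \<noteq> 0" "x \<in> rel_ideal q" "\<And>r. r \<in> relators q \<Longrightarrow> twisted_der t \<delta> r \<in> rel_ideal q"
  shows "twisted_der t \<delta> x \<in> rel_ideal q"
  using assms(2)
proof (induction rule: rel_ideal_induct)
  case (mult x y)
  then show ?case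
    using free_deg_twist_rel_ideal[OF assms(1) mult(1)]
    by (auto simp: twisted_der_mult[OF assms(1)] intro!: rel_ideal_add intro: rel_ideal_mult)
qed (use assms in \<open>auto simp: rel_ideal_add rel_ideal_uminus\<close>)

section \<open>The coordinates of the differential along \<open>e\<^sup>+\<close>,
  \<open>e\<^sup>-\<close> and \<open>e\<^sup>0\<close>\<close>

section \<open>The differential in coordinates\<close>

lemma UNIV_idx: "(UNIV :: idx set) = {Minus, Zero, Plus}"
  by (auto intro: idx.exhaust)

lemma sum_idx: "(\<Sum>i\<in>UNIV. f i) = f Minus + f Zero + f Plus"
  by (simp add: UNIV_idx add.assoc)

lemma (in abelian_monoid) finsum_idx:
  assumes "\<And>i. f i \<in> carrier G"
  shows "(\<Oplus>i\<in>UNIV. f i) = f Minus \<oplus> f Zero \<oplus> f Plus"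
  using assms by (simp add: UNIV_idx a_assoc)

text \<open>The \<open>r\<close>-integer of \<open>n\<close>, completed by its limit at
  \<open>r = 1\<close>. It is taken at \<open>r = q ^ 2\<close>, so this covers \<open>q = 1\<close>
  and \<open>q = -1\<close>.\<close>

definition quantum_int :: "complex \<Rightarrow> int \<Rightarrow> complex" where
  "quantum_int r n = (if r = 1 then of_int n else (r powi n - 1) / (r - 1))"

text \<open>This is the twisted Leibniz rule at the level of degrees; it makes the
  \<open>e\<^sup>0\<close> coordinate act as a scalar on each degree.\<close>

lemma quantum_int_add:
  "r \<noteq> 0 \<Longrightarrow> quantum_int r (m + n) = quantum_int r m * r powi n + quantum_int r n"
  by (auto simp: quantum_int_def power_int_add left_diff_distrib simp flip: add_divide_distrib)

lemma quantum_int_simps [simp]: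
  "quantum_int r 0 = 0" "quantum_int r 1 = 1" "r \<noteq> 0 \<Longrightarrow> quantum_int r (- 1) = - inverse r"
  by (auto simp: quantum_int_def power_int_minus divide_simps)

primrec diff_plus :: "complex \<Rightarrow> gen \<Rightarrow> free_alg" where
  "diff_plus q Gen_a = free_const q * free_gen Gen_b"
| "diff_plus q Gen_b = 0"
| "diff_plus q Gen_c = free_const q * free_gen Gen_d"
| "diff_plus q Gen_d = 0"

primrec diff_minus :: "gen \<Rightarrow> free_alg" where
  "diff_minus Gen_a = 0"
| "diff_minus Gen_b = free_gen Gen_a"
| "diff_minus Gen_c = 0"
| "diff_minus Gen_d = free_gen Gen_c"

text \<open>The prescribed coefficients, 1 on \<open>a\<close> and \<open>c\<close> and
  \<open>- inverse (q ^ 2)\<close> on \<open>b\<close> and \<open>d\<close>, are the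
  \<open>q ^ 2\<close>-integers of the degrees 1 and -1.\<close>

definition diff_zero :: "complex \<Rightarrow> gen \<Rightarrow> free_alg" where
  "diff_zero q x = free_const (quantum_int (q ^ 2) (gen_deg x)) * free_gen x"

locale quantum_sl2 =
  fixes q :: complex
  assumes q_nonzero: "q \<noteq> 0"
begin

abbreviation "K \<equiv> free_const q"
abbreviation "L \<equiv> free_const (inverse q)"
abbreviation "ga \<equiv> free_gen Gen_a"
abbreviation "gb \<equiv> free_gen Gen_b"
abbreviation "gc \<equiv> free_gen Gen_c"
abbreviation "gd \<equiv> free_gen Gen_d"

lemma KL: "K * L = 1" "L * K = 1"
  using q_nonzero by (simp_all flip: free_const_mult)

lemma cls_relations:
  "cls q (gb * ga) = cls q (K * (ga * gb))"
  "cls q (gc * ga) = cls q (K * (ga * gc))"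
  "cls q (gd * gb) = cls q (K * (gb * gd))"
  "cls q (gd * gc) = cls q (K * (gc * gd))"
  "cls q (gb * gc) = cls q (gc * gb)"
  "cls q (ga * gd) = cls q (1 + L * (gb * gc))"
  "cls q (gd * ga) = cls q (1 + K * (gb * gc))"
  by (rule cls_relator; simp add: relators_def Let_def mult.assoc)+

sublocale R: sl2_relations "CqSL2 q" "cls q K" "cls q L" "cls q ga" "cls q gb" "cls q gc" "cls q gd"
proof unfold_locales
qed (simp_all add: one_CqSL2 KL cls_relations(1-4,6,7) free_const_commute[of "free_gen _"],
  rule cls_relations(5))

abbreviation "Dp \<equiv> twisted_der q (diff_plus q)"
abbreviation "Dm \<equiv> twisted_der q diff_minus"
abbreviation "D0 \<equiv> twisted_der (q ^ 2) (diff_zero q)"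

lemmas D_mult [simp] =
  twisted_der_mult[OF q_nonzero] twisted_der_mult[OF power_not_zero[OF q_nonzero]]

lemma free_deg_twist_gens [simp]:
  "free_deg_twist q ga = K * ga" "free_deg_twist q gb = L * gb"
  "free_deg_twist q gc = K * gc" "free_deg_twist q gd = L * gd"
  by (simp_all add: free_deg_twist_gen power_int_minus)

text \<open>In degree 0 the factor vanishes, which is why differentials of sphere elements have no
  \<open>e\<^sup>0\<close> coordinate.\<close>

lemma D0_homog:
  assumes "p \<in> free_homog n"
  shows "D0 p = free_const (quantum_int (q ^ 2) n) * p"
proof -
  have *: "word_der (q ^ 2) (diff_zero q) xs =
    free_const (quantum_int (q ^ 2) (word_deg (Word xs))) * Poly_Mapping.single (Word xs) 1" for xs
  proof (induction xs)
    case (Cons x xs)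
    have "free_deg_twist (q ^ 2) (Poly_Mapping.single (Word xs) 1) =
      free_const ((q ^ 2) powi word_deg (Word xs)) * Poly_Mapping.single (Word xs) 1"
      by (simp add: free_deg_twist_homog free_homog_single)
    with Cons q_nonzero show ?case
      by (simp add: diff_zero_def quantum_int_add free_const_add free_const_mult ring_distribs
        single_Word_Cons mult.assoc free_const_left_commute[of "free_gen x"])
  qed simp
  show ?thesis
    unfolding twisted_der_def by (rule linear_ext_scalar[OF assms]) (auto simp: *)
qed

lemmas cls_unfold = cls_ops[symmetric] one_CqSL2[symmetric] zero_CqSL2[symmetric]

text \<open>Both derivations respect the defining relations, since the two sides reduce to the same
  normal form. The \<open>e\<^sup>0\<close> coordinate is settled by degrees in
  \<open>D0_relator\<close>.\<close>

lemma D_relations: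
  "cls q (Dp (gb * ga)) = cls q (Dp (K * ga * gb))" "cls q (Dm (gb * ga)) = cls q (Dm (K * ga * gb))"
  "cls q (Dp (gc * ga)) = cls q (Dp (K * ga * gc))" "cls q (Dm (gc * ga)) = cls q (Dm (K * ga * gc))"
  "cls q (Dp (gd * gb)) = cls q (Dp (K * gb * gd))" "cls q (Dm (gd * gb)) = cls q (Dm (K * gb * gd))"
  "cls q (Dp (gd * gc)) = cls q (Dp (K * gc * gd))" "cls q (Dm (gd * gc)) = cls q (Dm (K * gc * gd))"
  "cls q (Dp (gb * gc)) = cls q (Dp (gc * gb))" "cls q (Dm (gb * gc)) = cls q (Dm (gc * gb))"
  "cls q (Dp (ga * gd)) = cls q (Dp (1 + L * gb * gc))" "cls q (Dm (ga * gd)) = cls q (Dm (1 + L * gb * gc))"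
  "cls q (Dp (gd * ga)) = cls q (Dp (1 + K * gb * gc))" "cls q (Dm (gd * ga)) = cls q (Dm (1 + K * gb * gc))"
  \<comment> \<open>Classes are split into ring operations on letters; \<open>cls_ops\<close> would
    reassemble them.\<close>
  by (simp_all add: cls_unfold R.normal_form free_deg_twist_mult[OF q_nonzero] del: cls_ops)

lemma Dp_relator: "r \<in> relators q \<Longrightarrow> Dp r \<in> rel_ideal q"
  and Dm_relator: "r \<in> relators q \<Longrightarrow> Dm r \<in> rel_ideal q"
  unfolding relators_def Let_def
  by (elim insertE emptyE; simp only: twisted_der_diff cls_eq_iff[symmetric] D_relations)+

lemma D0_relator:
  assumes "r \<in> relators q"
  shows "D0 r \<in> rel_ideal q"
  using relators_homog[OF assms] assms relators_subset_rel_ideal[of q]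
  by (auto simp: D0_homog intro!: rel_ideal_mult(1))

lemma form_ops:
  "(cls q u, cls q v, cls q w) \<oplus>\<^bsub>Omega_SL2 q\<^esub> (cls q u', cls q v', cls q w') =
    (cls q (u + u'), cls q (v + v'), cls q (w + w'))"
  "cls q x \<odot>\<^bsub>Omega_SL2 q\<^esub> (cls q u, cls q v, cls q w) = (cls q (x * u), cls q (x * v), cls q (x * w))"
  "(cls q u, cls q v, cls q w) \<triangleleft>\<^bsub>Omega_SL2 q\<^esub> cls q x =
    (cls q (u * free_deg_twist q x), cls q (v * free_deg_twist q x), cls q (w * free_deg_twist (q ^ 2) x))"
  "\<zero>\<^bsub>Omega_SL2 q\<^esub> = (cls q 0, cls q 0, cls q 0)"
  using q_nonzero by (simp_all add: Omega_SL2_def deg_twist_cls zero_CqSL2)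

lemma carrier_Omega_SL2: "carrier (Omega_SL2 q) = {(cls q u, cls q v, cls q w) | u v w. True}"
  by (auto simp: Omega_SL2_def carrier_CqSL2)

lemma form_in_carrier [simp]: "(cls q u, cls q v, cls q w) \<in> carrier (Omega_SL2 q)"
  by (auto simp: carrier_Omega_SL2)

lemma abelian_group_Omega_SL2: "abelian_group (Omega_SL2 q)"
proof (rule abelian_groupI)
  fix x assume "x \<in> carrier (Omega_SL2 q)"
  then obtain u v w where x: "x = (cls q u, cls q v, cls q w)"
    by (auto simp: carrier_Omega_SL2)
  show "\<exists>y\<in>carrier (Omega_SL2 q). y \<oplus>\<^bsub>Omega_SL2 q\<^esub> x = \<zero>\<^bsub>Omega_SL2 q\<^esub>"
    by (rule bexI[of _ "(cls q (- u), cls q (- v), cls q (- w))"]) (simp_all add: x form_ops)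
qed (auto simp: carrier_Omega_SL2 form_ops add_ac)

sublocale SL2: abelian_group "Omega_SL2 q"
  by (rule abelian_group_Omega_SL2)

lemma gen_diff_eq: "gen_diff q x = (cls q (diff_plus q x), cls q (diff_minus x), cls q (diff_zero q x))"
  using q_nonzero
  by (cases x) (simp_all add: zero_CqSL2 cscale_def const_cls_def gen_cls_def diff_zero_def)

lemma word_diff_eq:
  "word_diff q xs = (cls q (word_der q (diff_plus q) xs), cls q (word_der q diff_minus xs),
    cls q (word_der (q ^ 2) (diff_zero q) xs))"
  by (induction xs) (simp_all add: form_ops gen_diff_eq gen_cls_def)

lemma free_diff_eq: "free_diff q p = (cls q (Dp p), cls q (Dm p), cls q (D0 p))"
proof -
  have "(\<Oplus>\<^bsub>Omega_SL2 q\<^esub>w\<in>A. const_cls q (z w) \<odot>\<^bsub>Omega_SL2 q\<^esub> word_diff q (letters w)) =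
     (cls q (\<Sum>w\<in>A. free_const (z w) * word_der q (diff_plus q) (letters w)),
      cls q (\<Sum>w\<in>A. free_const (z w) * word_der q diff_minus (letters w)),
      cls q (\<Sum>w\<in>A. free_const (z w) * word_der (q ^ 2) (diff_zero q) (letters w)))"
    if "finite A" for A z
    using that
  proof induction
    case (insert w A)
    then show ?case
      by (subst SL2.finsum_insert)
        (simp_all add: word_diff_eq const_cls_def form_ops)
  qed (simp add: form_ops)
  then show ?thesis
    by (simp add: free_diff_def twisted_der_def linear_ext_def)
qed

text \<open>Well-definedness of the differential: all three derivations map the relation ideal into
  itself.\<close>

lemma ext_diff_cls: "ext_diff q (cls q p) = (cls q (Dp p), cls q (Dm p), cls q (D0 p))"
proof -
  have "free_diff q x = free_diff q y" if "x - y \<in> rel_ideal q" for x y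
  proof -
    have "Dp (x - y) \<in> rel_ideal q" "Dm (x - y) \<in> rel_ideal q" "D0 (x - y) \<in> rel_ideal q"
      using that q_nonzero
      by (auto simp del: twisted_der_diff intro: twisted_der_rel_ideal Dp_relator Dm_relator D0_relator)
    then show ?thesis
      by (simp add: free_diff_eq cls_eq_iff)
  qed
  then show ?thesis
    unfolding ext_diff_def by (simp add: the_elem_image_cls free_diff_eq)
qed

section \<open>The matrices \<open>G\<close> and \<open>H\<close> and the two factors of
  \<open>E\<close>\<close>

primrec Gp :: "idx \<Rightarrow> free_alg" where
  "Gp Minus = gb * gb"
| "Gp Zero = K * (gb * gd)"
| "Gp Plus = gd * gd"

primrec Gm :: "idx \<Rightarrow> free_alg" where
  "Gm Minus = ga * ga"
| "Gm Zero = K * (ga * gc)"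
| "Gm Plus = gc * gc"

primrec Hp :: "idx \<Rightarrow> free_alg" where
  "Hp Minus = L * L * (gc * gc)"
| "Hp Zero = - ((1 + L * L) * (ga * gc))"
| "Hp Plus = ga * ga"

primrec Hm :: "idx \<Rightarrow> free_alg" where
  "Hm Minus = gd * gd"
| "Hm Zero = - ((1 + K * K) * (gb * gd))"
| "Hm Plus = K * K * (gb * gb)"

primrec e_col :: "idx \<Rightarrow> free_alg" where
  "e_col Minus = (K + L) * (ga * gb)"
| "e_col Zero = 1 + (K + L) * (gb * gc)"
| "e_col Plus = (K + L) * (gc * gd)"

primrec e_row :: "idx \<Rightarrow> free_alg" where
  "e_row Minus = - (gc * gd)"
| "e_row Zero = 1 + (K + L) * (gb * gc)"
| "e_row Plus = - (K * K * (ga * gb))"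

primrec b_elt :: "idx \<Rightarrow> free_alg" where
  "b_elt Minus = ga * gb"
| "b_elt Zero = gb * gc"
| "b_elt Plus = gc * gd"

lemma bS2_eq: "bS2 q i = cls q (b_elt i)"
  by (cases i) (simp_all add: gen_cls_def)

lemma E_col_eq: "E_col q i = cls q (e_col i)"
  by (cases i) (simp_all add: gen_cls_def cscale_def const_cls_def two_q_def free_const_add one_CqSL2)

lemma E_row_eq: "E_row q i = cls q (e_row i)"
  by (cases i) (simp_all add: gen_cls_def cscale_def const_cls_def two_q_def free_const_add one_CqSL2
    power2_eq_square free_const_mult free_const_uminus)

lemma E_mat_eq: "E_mat q i j = cls q (e_col i * e_row j)"
  by (simp add: E_mat_def E_col_eq E_row_eq)

lemma row_col: "cls q (\<Sum>i\<in>UNIV. e_row i * e_col i) = cls q 1"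
  using R.row_col_pos unfolding one_CqSL2 cls_ops cls_eq_iff
  by (simp add: sum_idx algebra_simps)

lemma GH: "cls q (Gp i * Hp j + Gm i * Hm j) = cls q ((if i = j then 1 else 0) - e_col i * e_row j)"
proof -
  note pos = R.GH_minus_pos R.GH_zero_pos R.GH_plus_pos
  note pos = pos[unfolded one_CqSL2 cls_ops cls_eq_iff]
  show ?thesis
    unfolding cls_eq_iff
    \<comment> \<open>The negated identities serve the \<open>Zero\<close> column, whose entries of
      \<open>H\<close> are negative.\<close>
    using pos pos[THEN rel_ideal_uminus]
    by (cases i; cases j) (simp_all add: algebra_simps)
qed

lemma HG:
  "cls q (\<Sum>i\<in>UNIV. Hp i * Gp i) = cls q 1" "cls q (\<Sum>i\<in>UNIV. Hp i * Gm i) = cls q 0"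
  "cls q (\<Sum>i\<in>UNIV. Hm i * Gp i) = cls q 0" "cls q (\<Sum>i\<in>UNIV. Hm i * Gm i) = cls q 1"
  using R.HG_pos[unfolded one_CqSL2 cls_ops cls_eq_iff]
  unfolding cls_eq_iff by (simp_all add: sum_idx algebra_simps)

lemma b_elt_homog: "b_elt i \<in> free_homog 0"
  by (cases i) (auto intro!: free_homog_mult[OF free_homog_gen free_homog_gen])

lemma KL_left: "K * (L * x) = x" "L * (K * x) = x"
  by (simp_all add: KL flip: mult.assoc)

text \<open>The coefficients come out already in the free algebra, where only scalars are commuted;
  degree 0 removes the \<open>e\<^sup>0\<close> part.\<close>

lemma ext_diff_bS2: "ext_diff q (bS2 q i) = (cls q (Gp i), cls q (Gm i), cls q 0)"
  unfolding bS2_eq ext_diff_cls D0_homog[OF b_elt_homog]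
  by (cases i) (simp_all add: mult.assoc free_const_left_commute[of "free_gen _"] KL_left)

end

section \<open>Balanced tensor products and their left action\<close>

section \<open>Balanced tensor products\<close>

text \<open>For the left action to descend to the quotient, it is taken to be additive on
  \<open>M\<close> and to commute with the right action that is balanced.\<close>

locale tensor_data =
  fixes R :: "('r, 'e) ring_scheme" and M :: "('r, 'm, 'e1) bimodule_scheme"
    and N :: "('r, 'n, 'e2) module_scheme"
  assumes abelian_M: "abelian_group M" and abelian_N: "abelian_group N"
    and smult_M [simp]: "r \<in> carrier R \<Longrightarrow> x \<in> carrier M \<Longrightarrow> r \<odot>\<^bsub>M\<^esub> x \<in> carrier M"
    and smult_N [simp]: "r \<in> carrier R \<Longrightarrow> y \<in> carrier N \<Longrightarrow> r \<odot>\<^bsub>N\<^esub> y \<in> carrier N"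
    and rsmult_M [simp]: "r \<in> carrier R \<Longrightarrow> x \<in> carrier M \<Longrightarrow> x \<triangleleft>\<^bsub>M\<^esub> r \<in> carrier M"
    and smult_add: "r \<in> carrier R \<Longrightarrow> x \<in> carrier M \<Longrightarrow> x' \<in> carrier M \<Longrightarrow>
      r \<odot>\<^bsub>M\<^esub> (x \<oplus>\<^bsub>M\<^esub> x') = r \<odot>\<^bsub>M\<^esub> x \<oplus>\<^bsub>M\<^esub> r \<odot>\<^bsub>M\<^esub> x'"
    and smult_rsmult: "r \<in> carrier R \<Longrightarrow> s \<in> carrier R \<Longrightarrow> x \<in> carrier M \<Longrightarrow>
      r \<odot>\<^bsub>M\<^esub> (x \<triangleleft>\<^bsub>M\<^esub> s) = (r \<odot>\<^bsub>M\<^esub> x) \<triangleleft>\<^bsub>M\<^esub> s"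
begin

abbreviation "F \<equiv> free_Abelian_group (carrier M \<times> carrier N)"
abbreviation "T \<equiv> tensor_product R M N"
abbreviation "k \<equiv> tensor_kernel R M N"
abbreviation "tc \<equiv> tensor_class R M N"
abbreviation tensor (infixl \<open>\<otimes>\<otimes>\<close> 70) where "x \<otimes>\<otimes> y \<equiv> pure_tensor R M N x y"

sublocale M: abelian_group M by (rule abelian_M)
sublocale N: abelian_group N by (rule abelian_N)
sublocale F: comm_group F by (rule abelian_free_Abelian_group)

lemma diff_in_F: "p \<in> carrier F \<Longrightarrow> p' \<in> carrier F \<Longrightarrow> p - p' \<in> carrier F"
  using keys_diff[of p p'] by auto

lemma relators_carrier: "tensor_relators R M N \<subseteq> carrier F"
  unfolding tensor_relators_def
  by (auto intro!: diff_in_F simp del: carrier_free_Abelian_group_iff)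

lemma kernel_subgroup: "subgroup k F"
  unfolding tensor_kernel_def by (rule F.generate_is_subgroup[OF relators_carrier])

sublocale k: normal k F
  by (rule F.subgroup_imp_normal[OF kernel_subgroup])

lemma kernel_closed:
  "0 \<in> k" "p \<in> k \<Longrightarrow> p' \<in> k \<Longrightarrow> p + p' \<in> k" "p \<in> k \<Longrightarrow> - p \<in> k"
proof -
  show "0 \<in> k" "p \<in> k \<Longrightarrow> p' \<in> k \<Longrightarrow> p + p' \<in> k"
    using k.one_closed k.m_closed[of p p'] by simp_all
  assume p: "p \<in> k"
  have "inv\<^bsub>F\<^esub> p = - p"
    using subsetD[OF k.subset p] by simp
  with k.m_inv_closed[OF p] show "- p \<in> k"
    by simp
qed

lemma in_tc_iff: "p \<in> carrier F \<Longrightarrow> p' \<in> tc p \<longleftrightarrow> p' - p \<in> k"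
  by (auto simp: tensor_class_def r_coset_def image_iff algebra_simps intro: bexI[of _ "p' - p"])

lemma tc_eq: "p \<in> carrier F \<Longrightarrow> p' \<in> carrier F \<Longrightarrow> p - p' \<in> k \<Longrightarrow> tc p = tc p'"
  unfolding tensor_class_def
  using kernel_closed(3)[of "p - p'"]
  by (intro F.repr_independence[OF _ _ kernel_subgroup]) (auto simp: r_coset_def intro: bexI[of _ "p' - p"])

lemma carrier_T: "carrier T = tc ` carrier F"
  by (auto simp: tensor_product_def Let_def FactGroup_def RCOSETS_def tensor_class_def)

lemma tc_in_carrier [simp]: "p \<in> carrier F \<Longrightarrow> tc p \<in> carrier T"
  by (simp only: carrier_T imageI)

lemma tc_add: "p \<in> carrier F \<Longrightarrow> p' \<in> carrier F \<Longrightarrow> tc p \<oplus>\<^bsub>T\<^esub> tc p' = tc (p + p')"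
  using k.rcos_sum[of p p']
  by (simp add: tensor_product_def Let_def tensor_class_def FactGroup_def)

lemma zero_T: "\<zero>\<^bsub>T\<^esub> = tc 0"
  using F.coset_mult_one[OF k.subset]
  by (simp add: tensor_product_def Let_def FactGroup_def tensor_class_def)

lemma abelian_group_T: "abelian_group T"
proof (rule abelian_groupI)
  have add: "p + p' \<in> carrier F" if "p \<in> carrier F" "p' \<in> carrier F" for p p'
    using F.m_closed[OF that] by simp
  have zero: "0 \<in> carrier F"
    using F.one_closed by simp
  fix x assume x: "x \<in> carrier T"
  then obtain p where p: "p \<in> carrier F" "x = tc p"
    unfolding carrier_T by blast
  then have "- p \<in> carrier F"
    by simp
  with p show "\<exists>y\<in>carrier T. y \<oplus>\<^bsub>T\<^esub> x = \<zero>\<^bsub>T\<^esub>"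
    by (intro bexI[of _ "tc (- p)"]) (simp_all only: tc_add zero_T left_minus tc_in_carrier)
  show "\<zero>\<^bsub>T\<^esub> \<oplus>\<^bsub>T\<^esub> x = x"
    using p by (simp only: zero_T tc_add zero add_0)
  fix y assume "y \<in> carrier T"
  then obtain p' where p': "p' \<in> carrier F" "y = tc p'"
    unfolding carrier_T by blast
  show "x \<oplus>\<^bsub>T\<^esub> y \<in> carrier T" "x \<oplus>\<^bsub>T\<^esub> y = y \<oplus>\<^bsub>T\<^esub> x"
    using p p' by (simp_all only: tc_add add tc_in_carrier add.commute)
  fix z assume "z \<in> carrier T"
  then obtain p'' where p'': "p'' \<in> carrier F" "z = tc p''"
    unfolding carrier_T by blast
  show "x \<oplus>\<^bsub>T\<^esub> y \<oplus>\<^bsub>T\<^esub> z = x \<oplus>\<^bsub>T\<^esub> (y \<oplus>\<^bsub>T\<^esub> z)"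
    using p p' p'' by (simp only: tc_add add add.assoc)
qed (simp add: zero_T tc_in_carrier)

sublocale T: abelian_group T
  by (rule abelian_group_T)

lemma tensor_in_carrier [simp]: "x \<in> carrier M \<Longrightarrow> y \<in> carrier N \<Longrightarrow> x \<otimes>\<otimes> y \<in> carrier T"
  by (simp add: pure_tensor_def)

lemma relators_kernel: "tensor_relators R M N \<subseteq> k"
  unfolding tensor_kernel_def by (auto intro: generate.incl)

lemma relatorI:
  "x \<in> carrier M \<Longrightarrow> x' \<in> carrier M \<Longrightarrow> y \<in> carrier N \<Longrightarrow>
    frag_of (x \<oplus>\<^bsub>M\<^esub> x', y) - frag_of (x, y) - frag_of (x', y) \<in> tensor_relators R M N"
  "x \<in> carrier M \<Longrightarrow> y \<in> carrier N \<Longrightarrow> y' \<in> carrier N \<Longrightarrow>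
    frag_of (x, y \<oplus>\<^bsub>N\<^esub> y') - frag_of (x, y) - frag_of (x, y') \<in> tensor_relators R M N"
  "x \<in> carrier M \<Longrightarrow> y \<in> carrier N \<Longrightarrow> s \<in> carrier R \<Longrightarrow>
    frag_of (x \<triangleleft>\<^bsub>M\<^esub> s, y) - frag_of (x, s \<odot>\<^bsub>N\<^esub> y) \<in> tensor_relators R M N"
  unfolding tensor_relators_def by blast+

lemma frag_of_add_carrier:
  "u \<in> carrier M \<times> carrier N \<Longrightarrow> v \<in> carrier M \<times> carrier N \<Longrightarrow> frag_of u + frag_of v \<in> carrier F"
  using F.m_closed[of "frag_of u" "frag_of v"] by simp

lemma tensor_add_left:
  assumes "x \<in> carrier M" "x' \<in> carrier M" "y \<in> carrier N"
  shows "(x \<oplus>\<^bsub>M\<^esub> x') \<otimes>\<otimes> y = x \<otimes>\<otimes> y \<oplus>\<^bsub>T\<^esub> x' \<otimes>\<otimes> y"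
proof -
  have "frag_of (x \<oplus>\<^bsub>M\<^esub> x', y) - (frag_of (x, y) + frag_of (x', y)) \<in> k"
    unfolding diff_diff_eq[symmetric]
    using assms by (intro subsetD[OF relators_kernel] relatorI)
  with assms show ?thesis
    by (simp add: pure_tensor_def tc_add tc_eq frag_of_add_carrier del: carrier_free_Abelian_group_iff)
qed

lemma tensor_add_right:
  assumes "x \<in> carrier M" "y \<in> carrier N" "y' \<in> carrier N"
  shows "x \<otimes>\<otimes> (y \<oplus>\<^bsub>N\<^esub> y') = x \<otimes>\<otimes> y \<oplus>\<^bsub>T\<^esub> x \<otimes>\<otimes> y'"
proof -
  have "frag_of (x, y \<oplus>\<^bsub>N\<^esub> y') - (frag_of (x, y) + frag_of (x, y')) \<in> k"
    unfolding diff_diff_eq[symmetric]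
    using assms by (intro subsetD[OF relators_kernel] relatorI)
  with assms show ?thesis
    by (simp add: pure_tensor_def tc_add tc_eq frag_of_add_carrier del: carrier_free_Abelian_group_iff)
qed

lemma tensor_balanced:
  assumes "x \<in> carrier M" "y \<in> carrier N" "r \<in> carrier R"
  shows "(x \<triangleleft>\<^bsub>M\<^esub> r) \<otimes>\<otimes> y = x \<otimes>\<otimes> (r \<odot>\<^bsub>N\<^esub> y)"
  unfolding pure_tensor_def
proof (rule tc_eq)
  show "frag_of (x \<triangleleft>\<^bsub>M\<^esub> r, y) - frag_of (x, r \<odot>\<^bsub>N\<^esub> y) \<in> k"
    using assms by (intro subsetD[OF relators_kernel] relatorI)
qed (use assms in simp_all)

abbreviation scale :: "'r \<Rightarrow> ('m \<times> 'n \<Rightarrow>\<^sub>0 int) \<Rightarrow> ('m \<times> 'n \<Rightarrow>\<^sub>0 int)" where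
  "scale r \<equiv> frag_extend (\<lambda>(x, y). frag_of (r \<odot>\<^bsub>M\<^esub> x, y))"

lemma scale_carrier:
  assumes "r \<in> carrier R" "p \<in> carrier F"
  shows "scale r p \<in> carrier F"
  using assms keys_frag_extend[of "\<lambda>(x, y). frag_of (r \<odot>\<^bsub>M\<^esub> x, y)" p]
  by (fastforce simp: keys_frag_of)

text \<open>Each relator goes to one of the same kind: additivity of the action serves the first
  kind, commuting with the right action the third.\<close>

lemma scale_relator:
  assumes r: "r \<in> carrier R" and "p \<in> tensor_relators R M N"
  shows "scale r p \<in> tensor_relators R M N"
  using assms(2)[unfolded tensor_relators_def Un_iff mem_Collect_eq]
proof (elim disjE exE conjE)
  fix x x' y assume "p = frag_of (x \<oplus>\<^bsub>M\<^esub> x', y) - frag_of (x, y) - frag_of (x', y)"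
    and x: "x \<in> carrier M" "x' \<in> carrier M" "y \<in> carrier N"
  then show ?thesis
    using relatorI(1)[OF smult_M[OF r x(1)] smult_M[OF r x(2)] x(3)] r
    by (simp add: frag_extend_diff smult_add)
next
  fix x y y' assume "p = frag_of (x, y \<oplus>\<^bsub>N\<^esub> y') - frag_of (x, y) - frag_of (x, y')"
    and x: "x \<in> carrier M" "y \<in> carrier N" "y' \<in> carrier N"
  then show ?thesis
    using relatorI(2)[OF smult_M[OF r x(1)] x(2,3)] by (simp add: frag_extend_diff)
next
  fix x s y assume "p = frag_of (x \<triangleleft>\<^bsub>M\<^esub> s, y) - frag_of (x, s \<odot>\<^bsub>N\<^esub> y)"
    and x: "x \<in> carrier M" "s \<in> carrier R" "y \<in> carrier N"
  then show ?thesis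
    using relatorI(3)[OF smult_M[OF r x(1)] x(3,2)] r by (simp add: frag_extend_diff smult_rsmult)
qed

lemma scale_kernel:
  assumes r: "r \<in> carrier R" and "p \<in> k"
  shows "scale r p \<in> k"
  using assms(2) unfolding tensor_kernel_def[of R M N]
proof (induction rule: generate.induct)
  case one
  then show ?case using kernel_closed(1) by (simp add: tensor_kernel_def)
next
  case (incl p)
  show ?case
    by (rule generate.incl[OF scale_relator[OF r incl]])
next
  case (inv p)
  have "- scale r p \<in> k"
    by (intro kernel_closed(3) subsetD[OF relators_kernel] scale_relator r inv)
  moreover have "inv\<^bsub>F\<^esub> p = - p"
    using subsetD[OF relators_carrier inv] by simp
  ultimately show ?case
    by (simp add: frag_extend_minus tensor_kernel_def)
next
  case (eng p p')
  then show ?case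
    using kernel_closed(2) by (simp add: frag_extend_add tensor_kernel_def)
qed

text \<open>Well-definedness of the left action: representatives that differ by the kernel still do
  so after scaling, so the image under \<open>the_elem\<close> is a singleton.\<close>

lemma smult_tc:
  assumes "r \<in> carrier R" "p \<in> carrier F"
  shows "r \<odot>\<^bsub>T\<^esub> tc p = tc (scale r p)"
proof -
  have "tc (scale r p') = tc (scale r p)" if "p' \<in> tc p" for p'
  proof (rule tc_eq)
    have p': "p' - p \<in> k"
      using that assms(2) by (simp add: in_tc_iff)
    then show "scale r p' - scale r p \<in> k"
      using scale_kernel[OF assms(1)] by (simp flip: frag_extend_diff)
    have "p' = (p' - p) \<otimes>\<^bsub>F\<^esub> p"
      by simp
    also have "\<dots> \<in> carrier F"
      using subsetD[OF k.subset p'] assms(2) by (rule F.m_closed)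
    finally show "scale r p' \<in> carrier F"
      by (rule scale_carrier[OF assms(1)])
  qed (use assms scale_carrier in blast)
  moreover have "p \<in> tc p"
    using assms(2) by (simp add: in_tc_iff kernel_closed)
  ultimately have "(\<lambda>p. tc (scale r p)) ` tc p = {tc (scale r p)}"
    by blast
  then show ?thesis
    by (simp add: tensor_product_def Let_def)
qed

lemma smult_T_closed [simp]: "r \<in> carrier R \<Longrightarrow> t \<in> carrier T \<Longrightarrow> r \<odot>\<^bsub>T\<^esub> t \<in> carrier T"
  using smult_tc scale_carrier tc_in_carrier unfolding carrier_T by fastforce

lemma smult_T_add:
  assumes "r \<in> carrier R" "t \<in> carrier T" "t' \<in> carrier T"
  shows "r \<odot>\<^bsub>T\<^esub> (t \<oplus>\<^bsub>T\<^esub> t') = r \<odot>\<^bsub>T\<^esub> t \<oplus>\<^bsub>T\<^esub> r \<odot>\<^bsub>T\<^esub> t'"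
proof -
  obtain p p' where p: "p \<in> carrier F" "p' \<in> carrier F" "t = tc p" "t' = tc p'"
    using assms(2,3) unfolding carrier_T by blast
  have "p + p' \<in> carrier F"
    using F.m_closed[OF p(1,2)] by simp
  with p assms(1) show ?thesis
    by (simp add: tc_add smult_tc scale_carrier frag_extend_add del: carrier_free_Abelian_group_iff)
qed

lemma smult_tensor:
  "r \<in> carrier R \<Longrightarrow> x \<in> carrier M \<Longrightarrow> y \<in> carrier N \<Longrightarrow> r \<odot>\<^bsub>T\<^esub> (x \<otimes>\<otimes> y) = (r \<odot>\<^bsub>M\<^esub> x) \<otimes>\<otimes> y"
  by (simp add: pure_tensor_def smult_tc)

lemma tensor_zero_left [simp]: "y \<in> carrier N \<Longrightarrow> \<zero>\<^bsub>M\<^esub> \<otimes>\<otimes> y = \<zero>\<^bsub>T\<^esub>"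
  using tensor_add_left[of "\<zero>\<^bsub>M\<^esub>" "\<zero>\<^bsub>M\<^esub>" y] T.add.r_cancel_one by fastforce

lemma tensor_zero_right [simp]: "x \<in> carrier M \<Longrightarrow> x \<otimes>\<otimes> \<zero>\<^bsub>N\<^esub> = \<zero>\<^bsub>T\<^esub>"
  using tensor_add_right[of x "\<zero>\<^bsub>N\<^esub>" "\<zero>\<^bsub>N\<^esub>"] T.add.r_cancel_one by fastforce

lemma tensor_minus_left:
  assumes "x \<in> carrier M" "y \<in> carrier N"
  shows "(\<ominus>\<^bsub>M\<^esub> x) \<otimes>\<otimes> y = \<ominus>\<^bsub>T\<^esub> (x \<otimes>\<otimes> y)"
  using assms tensor_add_left[of "\<ominus>\<^bsub>M\<^esub> x" x y]
  by (intro T.minus_equality[symmetric]) (simp_all add: M.l_neg)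

lemma smult_T_zero [simp]: "r \<in> carrier R \<Longrightarrow> r \<odot>\<^bsub>T\<^esub> \<zero>\<^bsub>T\<^esub> = \<zero>\<^bsub>T\<^esub>"
  using smult_T_add[of r "\<zero>\<^bsub>T\<^esub>" "\<zero>\<^bsub>T\<^esub>"] T.add.r_cancel_one by fastforce

lemma smult_T_minus:
  assumes "r \<in> carrier R" "t \<in> carrier T"
  shows "r \<odot>\<^bsub>T\<^esub> (\<ominus>\<^bsub>T\<^esub> t) = \<ominus>\<^bsub>T\<^esub> (r \<odot>\<^bsub>T\<^esub> t)"
  using assms smult_T_add[of r "\<ominus>\<^bsub>T\<^esub> t" t]
  by (intro T.minus_equality[symmetric]) (simp_all add: T.l_neg)

end

section \<open>One-forms on the sphere in the frame \<open>e\<^sup>+\<close>,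
  \<open>e\<^sup>-\<close>\<close>

section \<open>One-forms on the quantum sphere\<close>

context quantum_sl2
begin

lemma carrier_CqS2: "carrier (CqS2 q) = cls q ` free_homog 0"
  by (simp add: CqS2_def homog_eq)

lemma cls_in_CqS2 [intro]: "p \<in> free_homog 0 \<Longrightarrow> cls q p \<in> carrier (CqS2 q)"
  by (simp add: carrier_CqS2)

lemma CqS2_ops [simp]:
  "x \<otimes>\<^bsub>CqS2 q\<^esub> y = x \<otimes>\<^bsub>CqSL2 q\<^esub> y" "x \<oplus>\<^bsub>CqS2 q\<^esub> y = x \<oplus>\<^bsub>CqSL2 q\<^esub> y"
  "\<one>\<^bsub>CqS2 q\<^esub> = cls q 1" "\<zero>\<^bsub>CqS2 q\<^esub> = cls q 0"
  by (simp_all add: CqS2_def one_CqSL2 zero_CqSL2)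

lemma abelian_group_CqS2: "abelian_group (CqS2 q)"
proof (rule abelian_groupI)
  fix x assume "x \<in> carrier (CqS2 q)"
  then obtain p where p: "p \<in> free_homog 0" "x = cls q p"
    by (auto simp: carrier_CqS2)
  then show "\<exists>y\<in>carrier (CqS2 q). y \<oplus>\<^bsub>CqS2 q\<^esub> x = \<zero>\<^bsub>CqS2 q\<^esub>"
    by (intro bexI[of _ "cls q (- p)"]) (auto intro: free_homog_uminus)
qed (auto simp: carrier_CqS2 add_ac intro!: imageI free_homog_add)

sublocale S2: abelian_group "CqS2 q"
  by (rule abelian_group_CqS2)

lemma finsum_CqS2:
  "(\<And>i. p i \<in> free_homog 0) \<Longrightarrow> (\<Oplus>\<^bsub>CqS2 q\<^esub>i\<in>(UNIV::idx set). cls q (p i)) = cls q (\<Sum>i\<in>UNIV. p i)"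
  by (subst S2.finsum_idx) (auto simp: sum_idx)

text \<open>The degrees of \<open>H\<close> are opposite to those of \<open>G\<close>, so
  \<open>GH\<close> has degree 0 and \<open>(u, v) H\<close> has entries in the sphere algebra for
  \<open>u\<close>, \<open>v\<close> of degrees -2 and 2.\<close>

lemma e_col_homog: "e_col i \<in> free_homog 0"
  and e_row_homog: "e_row i \<in> free_homog 0"
  and Gp_homog: "Gp i \<in> free_homog (- 2)" and Gm_homog: "Gm i \<in> free_homog 2"
  and Hp_homog: "Hp i \<in> free_homog 2" and Hm_homog: "Hm i \<in> free_homog (- 2)"
proof -
  have gens: "free_gen x * free_gen y \<in> free_homog n" if "gen_deg x + gen_deg y = n" for x y n
    using free_homog_mult[OF free_homog_gen free_homog_gen that] .
  have scaled: "z * (free_gen x * free_gen y) \<in> free_homog n"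
    if "z \<in> {K, K + L, L * L, K * K, 1 + L * L, 1 + K * K}" "gen_deg x + gen_deg y = n" for z x y n
    using that(1) by (intro free_homog_mult[OF _ gens[OF that(2)], of _ 0])
      (auto intro!: free_homog_add simp flip: free_const_mult)
  show "e_col i \<in> free_homog 0"
    by (cases i) (auto intro!: free_homog_uminus free_homog_add scaled gens)
  show "e_row i \<in> free_homog 0"
    by (cases i) (auto intro!: free_homog_uminus free_homog_add scaled gens)
  show "Gp i \<in> free_homog (- 2)"
    by (cases i) (auto intro!: free_homog_uminus free_homog_add scaled gens)
  show "Gm i \<in> free_homog 2"
    by (cases i) (auto intro!: free_homog_uminus free_homog_add scaled gens)
  show "Hp i \<in> free_homog 2"
    by (cases i) (auto intro!: free_homog_uminus free_homog_add scaled gens)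
  show "Hm i \<in> free_homog (- 2)"
    by (cases i) (auto intro!: free_homog_uminus free_homog_add scaled gens)
qed

text \<open>If \<open>e\<^sup>+\<close> and \<open>e\<^sup>-\<close> are given degrees 2 and -2,
  these are the forms of total degree 0 without \<open>e\<^sup>0\<close> part.
  \<open>carrier_Omega_S2\<close> identifies them with the one-forms on the sphere.\<close>

definition S2_forms :: "form set" where
  "S2_forms = {(cls q u, cls q v, cls q 0) | u v. u \<in> free_homog (- 2) \<and> v \<in> free_homog 2}"

lemma S2_formsI [intro]:
  "u \<in> free_homog (- 2) \<Longrightarrow> v \<in> free_homog 2 \<Longrightarrow> (cls q u, cls q v, cls q 0) \<in> S2_forms"
  by (auto simp: S2_forms_def)

lemma S2_formsE [elim]:
  assumes "x \<in> S2_forms"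
  obtains u v where "u \<in> free_homog (- 2)" "v \<in> free_homog 2" "x = (cls q u, cls q v, cls q 0)"
  using assms by (auto simp: S2_forms_def)

lemma S2_forms_carrier: "x \<in> S2_forms \<Longrightarrow> x \<in> carrier (Omega_SL2 q)"
  by (elim S2_formsE) simp

lemma S2_forms_add:
  "x \<in> S2_forms \<Longrightarrow> y \<in> S2_forms \<Longrightarrow> x \<oplus>\<^bsub>Omega_SL2 q\<^esub> y \<in> S2_forms"
  by (elim S2_formsE) (auto simp: form_ops intro: free_homog_add)

lemma S2_forms_smult:
  "r \<in> carrier (CqS2 q) \<Longrightarrow> x \<in> S2_forms \<Longrightarrow> r \<odot>\<^bsub>Omega_SL2 q\<^esub> x \<in> S2_forms"
  by (elim S2_formsE) (auto simp: carrier_CqS2 form_ops intro!: S2_formsI free_homog_mult[of _ 0])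

text \<open>Twists fix elements of degree 0, so right multiplication does not disturb the
  degrees.\<close>

lemma S2_forms_rsmult:
  "r \<in> carrier (CqS2 q) \<Longrightarrow> x \<in> S2_forms \<Longrightarrow> x \<triangleleft>\<^bsub>Omega_SL2 q\<^esub> r \<in> S2_forms"
  by (elim S2_formsE)
    (auto simp: carrier_CqS2 form_ops free_deg_twist_homog intro!: S2_formsI free_homog_mult[of _ _ _ 0])

lemma ext_diff_S2: "p \<in> free_homog 0 \<Longrightarrow> ext_diff q (cls q p) = (cls q (Dp p), cls q (Dm p), cls q 0)"
  by (simp add: ext_diff_cls D0_homog)

text \<open>On generators, hence everywhere, \<open>Dp\<close> lowers the degree by 2 and
  \<open>Dm\<close> raises it by 2.\<close>

lemma ext_diff_S2_forms:
  assumes "p \<in> free_homog 0"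
  shows "ext_diff q (cls q p) \<in> S2_forms"
proof -
  have "diff_plus q x \<in> free_homog (gen_deg x + - 2)" "diff_minus x \<in> free_homog (gen_deg x + 2)" for x
    by (cases x; use free_homog_gen[of Gen_a] free_homog_gen[of Gen_b] free_homog_gen[of Gen_c]
        free_homog_gen[of Gen_d] in \<open>simp add: free_homog_const_mult\<close>)+
  from this[THEN twisted_der_homog, OF assms] show ?thesis
    unfolding ext_diff_S2[OF assms] by (intro S2_formsI) simp_all
qed

lemma S2_forms_subgroup: "subgroup S2_forms (add_monoid (Omega_SL2 q))"
proof (rule SL2.add.subgroupI)
  show "S2_forms \<subseteq> carrier (Omega_SL2 q)"
    by auto
  show "S2_forms \<noteq> {}"
    using S2_formsI[OF free_homog_0 free_homog_0] by blast
  show "\<ominus>\<^bsub>Omega_SL2 q\<^esub> x \<in> S2_forms" if "x \<in> S2_forms" for x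
  proof -
    obtain u v where x: "u \<in> free_homog (- 2)" "v \<in> free_homog 2" "x = (cls q u, cls q v, cls q 0)"
      using \<open>x \<in> S2_forms\<close> by blast
    have "\<ominus>\<^bsub>Omega_SL2 q\<^esub> x = (cls q (- u), cls q (- v), cls q 0)"
      by (rule SL2.minus_equality) (simp_all add: x form_ops)
    with x show ?thesis
      by (auto intro: free_homog_uminus)
  qed
qed (auto intro: S2_forms_add)

lemma expansion:
  "(\<Sum>i\<in>UNIV. (u * Hp i + v * Hm i) * Gp i) = u * (\<Sum>i\<in>UNIV. Hp i * Gp i) + v * (\<Sum>i\<in>UNIV. Hm i * Gp i)"
  "(\<Sum>i\<in>UNIV. (u * Hp i + v * Hm i) * Gm i) = u * (\<Sum>i\<in>UNIV. Hp i * Gm i) + v * (\<Sum>i\<in>UNIV. Hm i * Gm i)"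
  by (simp_all add: sum_idx algebra_simps)

text \<open>\<open>HG = 1\<close> gives \<open>((u, v) H) G = (u, v)\<close>, so
  \<open>(u, v) H\<close> holds coefficients of a form with respect to the
  \<open>db\<close>.\<close>

lemma cls_expansion:
  "cls q (\<Sum>i\<in>UNIV. (u * Hp i + v * Hm i) * Gp i) = cls q u"
  "cls q (\<Sum>i\<in>UNIV. (u * Hp i + v * Hm i) * Gm i) = cls q v"
  unfolding expansion
  using cls_add_cong[OF cls_mult_cong[OF refl HG(1)] cls_mult_cong[OF refl HG(3)], of u v]
    cls_add_cong[OF cls_mult_cong[OF refl HG(2)] cls_mult_cong[OF refl HG(4)], of u v]
  by simp_all

lemma combination:
  "cls q (p Minus) \<odot>\<^bsub>Omega_SL2 q\<^esub> ext_diff q (bS2 q Minus)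
   \<oplus>\<^bsub>Omega_SL2 q\<^esub> cls q (p Zero) \<odot>\<^bsub>Omega_SL2 q\<^esub> ext_diff q (bS2 q Zero)
   \<oplus>\<^bsub>Omega_SL2 q\<^esub> cls q (p Plus) \<odot>\<^bsub>Omega_SL2 q\<^esub> ext_diff q (bS2 q Plus) =
   (cls q (\<Sum>i\<in>UNIV. p i * Gp i), cls q (\<Sum>i\<in>UNIV. p i * Gm i), cls q 0)"
  by (simp add: ext_diff_bS2 form_ops sum_idx del: bS2.simps)

lemma Omega_S2_ops [simp]:
  "x \<oplus>\<^bsub>Omega_S2 q\<^esub> y = x \<oplus>\<^bsub>Omega_SL2 q\<^esub> y" "r \<odot>\<^bsub>Omega_S2 q\<^esub> x = r \<odot>\<^bsub>Omega_SL2 q\<^esub> x"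
  "x \<triangleleft>\<^bsub>Omega_S2 q\<^esub> r = x \<triangleleft>\<^bsub>Omega_SL2 q\<^esub> r" "\<zero>\<^bsub>Omega_S2 q\<^esub> = \<zero>\<^bsub>Omega_SL2 q\<^esub>"
  by (simp_all add: Omega_S2_def)

text \<open>Products \<open>m dn\<close> lie in the subgroup \<open>S2_forms\<close>. Conversely the
  entries of \<open>(u, v) H\<close> write a form as a combination of the \<open>db\<close>, which
  therefore generate the module.\<close>

lemma carrier_Omega_S2: "carrier (Omega_S2 q) = S2_forms"
proof
  let ?A = "{m \<odot>\<^bsub>Omega_SL2 q\<^esub> ext_diff q n | m n. m \<in> carrier (CqS2 q) \<and> n \<in> carrier (CqS2 q)}"
  have "?A \<subseteq> S2_forms"
    using ext_diff_S2_forms by (auto simp: carrier_CqS2 intro!: S2_forms_smult)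
  then show "carrier (Omega_S2 q) \<subseteq> S2_forms"
    using SL2.add.generate_subgroup_incl[OF _ S2_forms_subgroup] by (simp add: Omega_S2_def)
  show "S2_forms \<subseteq> carrier (Omega_S2 q)"
  proof
    fix x assume "x \<in> S2_forms"
    then obtain u v where x: "u \<in> free_homog (- 2)" "v \<in> free_homog 2" "x = (cls q u, cls q v, cls q 0)"
      by blast
    let ?p = "\<lambda>i. u * Hp i + v * Hm i"
    have "?p i \<in> free_homog 0" for i
      using x by (auto intro!: free_homog_add free_homog_mult[OF _ Hp_homog] free_homog_mult[OF _ Hm_homog])
    then have gen: "cls q (?p i) \<odot>\<^bsub>Omega_SL2 q\<^esub> ext_diff q (bS2 q i) \<in> generate (add_monoid (Omega_SL2 q)) ?A" for i
      using b_elt_homog unfolding bS2_eq by (intro generate.incl) blast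
    have "x = cls q (?p Minus) \<odot>\<^bsub>Omega_SL2 q\<^esub> ext_diff q (bS2 q Minus)
      \<oplus>\<^bsub>Omega_SL2 q\<^esub> cls q (?p Zero) \<odot>\<^bsub>Omega_SL2 q\<^esub> ext_diff q (bS2 q Zero)
      \<oplus>\<^bsub>Omega_SL2 q\<^esub> cls q (?p Plus) \<odot>\<^bsub>Omega_SL2 q\<^esub> ext_diff q (bS2 q Plus)"
      using combination[of ?p] by (simp only: cls_expansion x(3))
    also have "\<dots> \<in> generate (add_monoid (Omega_SL2 q)) ?A"
      using generate.eng[OF generate.eng[OF gen[of Minus] gen[of Zero]] gen[of Plus]]
      by (simp only: monoid.simps)
    finally show "x \<in> carrier (Omega_S2 q)"
      by (simp add: Omega_S2_def)
  qed
qed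

lemma abelian_group_Omega_S2: "abelian_group (Omega_S2 q)"
proof (rule abelian_groupI)
  fix x assume x: "x \<in> carrier (Omega_S2 q)"
  then have "\<ominus>\<^bsub>Omega_SL2 q\<^esub> x \<in> S2_forms" "x \<in> carrier (Omega_SL2 q)"
    using subgroup.m_inv_closed[OF S2_forms_subgroup] by (auto simp: a_inv_def carrier_Omega_S2)
  then show "\<exists>y\<in>carrier (Omega_S2 q). y \<oplus>\<^bsub>Omega_S2 q\<^esub> x = \<zero>\<^bsub>Omega_S2 q\<^esub>"
    by (intro bexI[of _ "\<ominus>\<^bsub>Omega_SL2 q\<^esub> x"]) (auto simp: carrier_Omega_S2 SL2.l_neg)
  show "\<zero>\<^bsub>Omega_S2 q\<^esub> \<oplus>\<^bsub>Omega_S2 q\<^esub> x = x"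
    using x by (simp add: carrier_Omega_S2 S2_forms_carrier)
next
  show "\<zero>\<^bsub>Omega_S2 q\<^esub> \<in> carrier (Omega_S2 q)"
    using S2_formsI[OF free_homog_0 free_homog_0] by (simp add: carrier_Omega_S2 form_ops)
qed (simp_all add: carrier_Omega_S2 S2_forms_add S2_forms_carrier SL2.a_ac)

sublocale T: tensor_data "CqS2 q" "Omega_S2 q" "Omega_S2 q"
proof (rule tensor_data.intro)
  show "r \<odot>\<^bsub>Omega_S2 q\<^esub> (x \<oplus>\<^bsub>Omega_S2 q\<^esub> x') = r \<odot>\<^bsub>Omega_S2 q\<^esub> x \<oplus>\<^bsub>Omega_S2 q\<^esub> r \<odot>\<^bsub>Omega_S2 q\<^esub> x'"
    if "r \<in> carrier (CqS2 q)" "x \<in> carrier (Omega_S2 q)" "x' \<in> carrier (Omega_S2 q)" for r x x'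
    using that unfolding carrier_Omega_S2 carrier_CqS2
    by (elim S2_formsE imageE) (simp add: form_ops ring_distribs)
  show "r \<odot>\<^bsub>Omega_S2 q\<^esub> (x \<triangleleft>\<^bsub>Omega_S2 q\<^esub> s) = (r \<odot>\<^bsub>Omega_S2 q\<^esub> x) \<triangleleft>\<^bsub>Omega_S2 q\<^esub> s"
    if "r \<in> carrier (CqS2 q)" "s \<in> carrier (CqS2 q)" "x \<in> carrier (Omega_S2 q)" for r s x
    using that unfolding carrier_Omega_S2 carrier_CqS2
    by (elim S2_formsE imageE) (simp add: form_ops mult.assoc)
qed (simp_all add: abelian_group_Omega_S2 carrier_Omega_S2 S2_forms_smult S2_forms_rsmult)

end

section \<open>Idempotence of \<open>E\<close> and the module isomorphism\<close>

section \<open>The projector and its image\<close>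

text \<open>The additive group of matrices, needed to identify the negative of \<open>E\<close> in
  \<open>1 - E\<close> through uniqueness of inverses.\<close>

lemma abelian_group_mat_ring:
  assumes "abelian_group R"
  shows "abelian_group (mat_ring R :: ('i::finite \<Rightarrow> 'i \<Rightarrow> 'r) ring)"
proof -
  interpret abelian_group R by fact
  show ?thesis
  proof (rule abelian_groupI)
    fix A :: "'i \<Rightarrow> 'i \<Rightarrow> 'r" assume "A \<in> carrier (mat_ring R)"
    then show "\<exists>B\<in>carrier (mat_ring R). B \<oplus>\<^bsub>mat_ring R\<^esub> A = \<zero>\<^bsub>mat_ring R\<^esub>"
      by (intro bexI[of _ "\<lambda>i j. \<ominus>\<^bsub>R\<^esub> A i j"]) (simp_all add: mat_ring_def l_neg)
  qed (auto simp: mat_ring_def a_ac fun_eq_iff)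
qed

context quantum_sl2
begin

lemma row_G: "cls q (\<Sum>i\<in>UNIV. e_row i * Gp i) = cls q 0" "cls q (\<Sum>i\<in>UNIV. e_row i * Gm i) = cls q 0"
  using R.row_G_pos[unfolded one_CqSL2 cls_ops cls_eq_iff]
  unfolding cls_eq_iff by (simp_all add: sum_idx algebra_simps)

lemma E_mat_in_carrier: "E_mat q \<in> carrier (mat_ring (CqS2 q))"
  by (auto simp: mat_ring_def E_mat_eq intro!: cls_in_CqS2 free_homog_mult[OF e_col_homog e_row_homog])

text \<open>A row times column in the middle of a product contracts to 1. This yields both
  \<open>E E = E\<close> and \<open>E col = col\<close>.\<close>

lemma insert_row_col:
  "cls q (\<Sum>k\<in>UNIV. x * e_row k * (e_col k * y)) = cls q (x * y)"
proof -
  have "(\<Sum>k\<in>UNIV. x * e_row k * (e_col k * y)) = x * (\<Sum>k\<in>UNIV. e_row k * e_col k) * y"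
    by (simp add: sum_idx algebra_simps)
  then show ?thesis
    using cls_mult_cong[OF cls_mult_cong[OF refl row_col] refl, of x y] by simp
qed

lemma E_mat_idem: "E_mat q \<otimes>\<^bsub>mat_ring (CqS2 q)\<^esub> E_mat q = E_mat q"
proof (intro ext)
  fix i j
  have "(E_mat q \<otimes>\<^bsub>mat_ring (CqS2 q)\<^esub> E_mat q) i j =
    (\<Oplus>\<^bsub>CqS2 q\<^esub>k\<in>UNIV. cls q (e_col i * e_row k * (e_col k * e_row j)))"
    by (simp add: mat_ring_def E_mat_eq)
  also have "\<dots> = cls q (\<Sum>k\<in>UNIV. e_col i * e_row k * (e_col k * e_row j))"
    by (intro finsum_CqS2 free_homog_mult[of _ 0 _ 0] e_col_homog e_row_homog) simp_all
  also have "\<dots> = E_mat q i j"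
    by (simp add: insert_row_col E_mat_eq)
  finally show "(E_mat q \<otimes>\<^bsub>mat_ring (CqS2 q)\<^esub> E_mat q) i j = E_mat q i j" .
qed

text \<open>The complementary projector factors as \<open>GH\<close>, through the two frame
  coordinates.\<close>

lemma one_minus_E:
  "\<one>\<^bsub>mat_ring (CqS2 q)\<^esub> \<ominus>\<^bsub>mat_ring (CqS2 q)\<^esub> E_mat q = (\<lambda>i j. cls q (Gp i * Hp j + Gm i * Hm j))"
proof -
  interpret M: abelian_group "mat_ring (CqS2 q) :: (idx \<Rightarrow> idx \<Rightarrow> free_alg set) ring"
    by (rule abelian_group_mat_ring[OF abelian_group_CqS2])
  have "\<ominus>\<^bsub>mat_ring (CqS2 q)\<^esub> E_mat q = (\<lambda>i j. cls q (- (e_col i * e_row j)))"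
  proof (rule M.minus_equality[OF _ E_mat_in_carrier])
    show "(\<lambda>i j. cls q (- (e_col i * e_row j))) \<in> carrier (mat_ring (CqS2 q))"
      by (auto simp: mat_ring_def intro!: cls_in_CqS2 free_homog_uminus free_homog_mult[OF e_col_homog e_row_homog])
  qed (simp add: mat_ring_def E_mat_eq)
  then show ?thesis
    by (auto simp: a_minus_def mat_ring_def GH fun_eq_iff)
qed

text \<open>The row vector \<open>(u, v) H\<close>.\<close>

definition frame_row :: "free_alg \<Rightarrow> free_alg \<Rightarrow> idx \<Rightarrow> free_alg set" where
  "frame_row u v = (\<lambda>i. cls q (u * Hp i + v * Hm i))"

text \<open>Associativity: \<open>p (1 - E) = p (G H) = (p G) H\<close>.\<close>

lemma row_times_one_minus_E:
  assumes "\<And>i. p i \<in> free_homog 0"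
  shows "row_times_mat (CqS2 q) (\<lambda>i. cls q (p i)) (\<one>\<^bsub>mat_ring (CqS2 q)\<^esub> \<ominus>\<^bsub>mat_ring (CqS2 q)\<^esub> E_mat q) =
    frame_row (\<Sum>i\<in>UNIV. p i * Gp i) (\<Sum>i\<in>UNIV. p i * Gm i)"
proof
  fix j
  have "Gp k * Hp j + Gm k * Hm j \<in> free_homog 0" for k
    by (auto intro!: free_homog_add free_homog_mult[OF Gp_homog Hp_homog] free_homog_mult[OF Gm_homog Hm_homog])
  then have "(\<Oplus>\<^bsub>CqS2 q\<^esub>k\<in>UNIV. cls q (p k * (Gp k * Hp j + Gm k * Hm j))) =
    cls q (\<Sum>k\<in>UNIV. p k * (Gp k * Hp j + Gm k * Hm j))"
    using assms by (intro finsum_CqS2 free_homog_mult[of _ 0 _ 0]) simp_all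
  then show "row_times_mat (CqS2 q) (\<lambda>i. cls q (p i))
      (\<one>\<^bsub>mat_ring (CqS2 q)\<^esub> \<ominus>\<^bsub>mat_ring (CqS2 q)\<^esub> E_mat q) j =
    frame_row (\<Sum>i\<in>UNIV. p i * Gp i) (\<Sum>i\<in>UNIV. p i * Gm i) j"
    by (simp add: row_times_mat_def one_minus_E frame_row_def sum_idx algebra_simps)
qed

text \<open>Chooses representatives of degree 0 for all entries at once, so that rows are computed
  in the free algebra.\<close>

lemma row_rep:
  assumes "v \<in> carrier (row_module (CqS2 q))"
  obtains p where "\<And>i. p i \<in> free_homog 0" "v = (\<lambda>i. cls q (p i))"
proof -
  have "\<forall>i. \<exists>r. r \<in> free_homog 0 \<and> v i = cls q r"
    using assms by (auto simp: row_module_def carrier_CqS2)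
  then obtain p where "\<forall>i. p i \<in> free_homog 0 \<and> v i = cls q (p i)"
    by metis
  then show ?thesis
    by (intro that[of p]) auto
qed

abbreviation "projected_rows \<equiv>
  row_module_times (CqS2 q) (\<one>\<^bsub>mat_ring (CqS2 q)\<^esub> \<ominus>\<^bsub>mat_ring (CqS2 q)\<^esub> E_mat q)"

lemma sum_Gp_homog: "(\<And>i. p i \<in> free_homog 0) \<Longrightarrow> (\<Sum>i\<in>UNIV. p i * Gp i) \<in> free_homog (- 2)"
  and sum_Gm_homog: "(\<And>i. p i \<in> free_homog 0) \<Longrightarrow> (\<Sum>i\<in>UNIV. p i * Gm i) \<in> free_homog 2"
  by (auto intro!: free_homog_sum free_homog_mult[OF _ Gp_homog] free_homog_mult[OF _ Gm_homog])

lemma frame_row_cong: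
  "cls q u = cls q u' \<Longrightarrow> cls q v = cls q v' \<Longrightarrow> frame_row u v = frame_row u' v'"
  unfolding frame_row_def by (intro ext cls_add_cong cls_mult_cong refl)

lemma frame_row_homog:
  "u \<in> free_homog (- 2) \<Longrightarrow> v \<in> free_homog 2 \<Longrightarrow> u * Hp i + v * Hm i \<in> free_homog 0"
  by (auto intro!: free_homog_add free_homog_mult[OF _ Hp_homog] free_homog_mult[OF _ Hm_homog])

text \<open>One inclusion is \<open>p (1 - E) = (p G) H\<close>. Conversely
  \<open>(u, v) H (1 - E) = (u, v) H G H = (u, v) H\<close>, so such a row is its own
  preimage.\<close>

lemma carrier_projected_rows:
  "carrier projected_rows = {frame_row u v | u v. u \<in> free_homog (- 2) \<and> v \<in> free_homog 2}"
proof (intro equalityI subsetI)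
  fix x assume "x \<in> carrier projected_rows"
  then obtain w where w: "w \<in> carrier (row_module (CqS2 q))"
    "x = row_times_mat (CqS2 q) w (\<one>\<^bsub>mat_ring (CqS2 q)\<^esub> \<ominus>\<^bsub>mat_ring (CqS2 q)\<^esub> E_mat q)"
    by (auto simp: row_module_times_def)
  obtain p where "\<And>i. p i \<in> free_homog 0" "w = (\<lambda>i. cls q (p i))"
    using row_rep[OF w(1)] by blast
  then show "x \<in> {frame_row u v | u v. u \<in> free_homog (- 2) \<and> v \<in> free_homog 2}"
    using w(2) row_times_one_minus_E sum_Gp_homog sum_Gm_homog by blast
next
  fix x assume "x \<in> {frame_row u v | u v. u \<in> free_homog (- 2) \<and> v \<in> free_homog 2}"
  then obtain u v where x: "x = frame_row u v" "u \<in> free_homog (- 2)" "v \<in> free_homog 2"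
    by blast
  have "frame_row u v \<in> carrier (row_module (CqS2 q))"
    using frame_row_homog[OF x(2,3)] by (auto simp: row_module_def frame_row_def)
  moreover have "row_times_mat (CqS2 q) (frame_row u v)
      (\<one>\<^bsub>mat_ring (CqS2 q)\<^esub> \<ominus>\<^bsub>mat_ring (CqS2 q)\<^esub> E_mat q) = frame_row u v"
    using row_times_one_minus_E[OF frame_row_homog[OF x(2,3)]]
      frame_row_cong[OF cls_expansion, of u v]
    by (simp add: frame_row_def)
  ultimately show "x \<in> carrier projected_rows"
    unfolding x(1) by (force simp: row_module_times_def)
qed

definition frame_map :: "(idx \<Rightarrow> free_alg set) \<Rightarrow> form" where
  "frame_map v = v Minus \<odot>\<^bsub>Omega_S2 q\<^esub> ext_diff q (bS2 q Minus)
    \<oplus>\<^bsub>Omega_S2 q\<^esub> v Zero \<odot>\<^bsub>Omega_S2 q\<^esub> ext_diff q (bS2 q Zero)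
    \<oplus>\<^bsub>Omega_S2 q\<^esub> v Plus \<odot>\<^bsub>Omega_S2 q\<^esub> ext_diff q (bS2 q Plus)"

lemma frame_map_cls:
  "frame_map (\<lambda>i. cls q (p i)) = (cls q (\<Sum>i\<in>UNIV. p i * Gp i), cls q (\<Sum>i\<in>UNIV. p i * Gm i), cls q 0)"
  using combination[of p] by (simp add: frame_map_def del: bS2.simps)

lemma frame_map_frame_row: "frame_map (frame_row u v) = (cls q u, cls q v, cls q 0)"
  by (simp only: frame_row_def frame_map_cls cls_expansion)

text \<open>On \<open>(u, v) H\<close> the map returns \<open>(u, v)\<close> because
  \<open>HG = 1\<close>. It is injective since \<open>frame_row\<close> depends only on the classes
  of \<open>u\<close> and \<open>v\<close>.\<close>

lemma frame_map_iso: "left_module_iso (CqS2 q) projected_rows (Omega_S2 q) frame_map"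
  unfolding left_module_iso_def
proof (intro conjI ballI)
  show "bij_betw frame_map (carrier projected_rows) (carrier (Omega_S2 q))"
  proof (rule bij_betw_imageI)
    show "inj_on frame_map (carrier projected_rows)"
      unfolding carrier_projected_rows
      by (auto simp: inj_on_def frame_map_frame_row intro: frame_row_cong)
    show "frame_map ` carrier projected_rows = carrier (Omega_S2 q)"
      unfolding carrier_projected_rows carrier_Omega_S2 S2_forms_def
      by (force simp: frame_map_frame_row)
  qed
next
  fix x y assume "x \<in> carrier projected_rows" "y \<in> carrier projected_rows"
  then obtain u v u' v' where xy: "x = frame_row u v" "y = frame_row u' v'"
    unfolding carrier_projected_rows by blast
  have "x \<oplus>\<^bsub>projected_rows\<^esub> y = frame_row (u + u') (v + v')"
    by (simp add: xy row_module_times_def row_module_def frame_row_def algebra_simps)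
  then show "frame_map (x \<oplus>\<^bsub>projected_rows\<^esub> y) = frame_map x \<oplus>\<^bsub>Omega_S2 q\<^esub> frame_map y"
    by (simp add: xy frame_map_frame_row form_ops)
next
  fix r x assume "r \<in> carrier (CqS2 q)" "x \<in> carrier projected_rows"
  then obtain p u v where rx: "r = cls q p" "x = frame_row u v"
    unfolding carrier_projected_rows carrier_CqS2 by blast
  have "r \<odot>\<^bsub>projected_rows\<^esub> x = frame_row (p * u) (p * v)"
    by (simp add: rx row_module_times_def row_module_def frame_row_def algebra_simps)
  then show "frame_map (r \<odot>\<^bsub>projected_rows\<^esub> x) = r \<odot>\<^bsub>Omega_S2 q\<^esub> frame_map x"
    by (simp add: rx frame_map_frame_row form_ops)
qed

section \<open>The matrix \<open>E dE\<close> of one-forms\<close>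

abbreviation "db i \<equiv> ext_diff q (bS2 q i)"
abbreviation "drow i \<equiv> ext_diff q (cls q (e_row i))"
abbreviation "dcol i \<equiv> ext_diff q (cls q (e_col i))"

lemma forms_in_carrier:
  "db i \<in> carrier (Omega_S2 q)" "drow i \<in> carrier (Omega_S2 q)" "dcol i \<in> carrier (Omega_S2 q)"
  unfolding carrier_Omega_S2 bS2_eq
  by (simp_all add: ext_diff_S2_forms b_elt_homog e_row_homog e_col_homog)

lemma finsum_forms:
  assumes "\<And>j. f j = (cls q (u j), cls q (v j), cls q (w j))" "\<And>j. f j \<in> carrier (Omega_S2 q)"
  shows "(\<Oplus>\<^bsub>Omega_S2 q\<^esub>j\<in>(UNIV::idx set). f j) =
    (cls q (\<Sum>j\<in>UNIV. u j), cls q (\<Sum>j\<in>UNIV. v j), cls q (\<Sum>j\<in>UNIV. w j))"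
  using T.M.finsum_idx[OF assms(2)] by (simp add: assms(1) form_ops sum_idx)

text \<open>The factor \<open>E dcol\<close> in the Leibniz expansion
  \<open>E dE = (E dcol) row + E col drow\<close>.\<close>

definition E_dcol :: "idx \<Rightarrow> form" where
  "E_dcol i = (\<Oplus>\<^bsub>Omega_S2 q\<^esub>j\<in>UNIV. E_mat q i j \<odot>\<^bsub>Omega_S2 q\<^esub> dcol j)"

lemma E_mat_cls_in_CqS2: "E_mat q i j \<in> carrier (CqS2 q)"
  unfolding E_mat_eq by (intro cls_in_CqS2 free_homog_mult[OF e_col_homog e_row_homog]) simp

lemma E_term_in_carrier: "E_mat q i j \<odot>\<^bsub>Omega_S2 q\<^esub> dcol j \<in> carrier (Omega_S2 q)"
  by (intro T.smult_M E_mat_cls_in_CqS2 forms_in_carrier)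

lemma E_dcol_in_carrier: "E_dcol i \<in> carrier (Omega_S2 q)"
  unfolding E_dcol_def by (intro T.M.finsum_closed) (simp only: Pi_iff E_term_in_carrier, simp)

text \<open>One coordinate of that expansion: \<open>y\<close> is the derivative of the column,
  \<open>t\<close> the twisted row entry and \<open>x\<close> its derivative. The last term is
  simplified by \<open>E col = col\<close>.\<close>

lemma E_leibniz:
  "cls q (\<Sum>j\<in>UNIV. e_col i * e_row j * (y j * t + e_col j * x)) =
   cls q ((\<Sum>j\<in>UNIV. e_col i * e_row j * y j) * t + e_col i * x)"
proof -
  have "(\<Sum>j\<in>UNIV. e_col i * e_row j * (y j * t + e_col j * x)) =
    (\<Sum>j\<in>UNIV. e_col i * e_row j * y j) * t + (\<Sum>j\<in>UNIV. e_col i * e_row j * (e_col j * x))"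
    by (simp add: sum_idx algebra_simps)
  then show ?thesis
    using cls_add_cong[OF refl insert_row_col] by simp
qed

lemma E_dE_eq:
  "E_dE q i k = E_dcol i \<triangleleft>\<^bsub>Omega_S2 q\<^esub> cls q (e_row k) \<oplus>\<^bsub>Omega_S2 q\<^esub> cls q (e_col i) \<odot>\<^bsub>Omega_S2 q\<^esub> drow k"
proof -
  have "E_mat q i j \<odot>\<^bsub>Omega_S2 q\<^esub> dcol j = (cls q (e_col i * e_row j * Dp (e_col j)),
    cls q (e_col i * e_row j * Dm (e_col j)), cls q (e_col i * e_row j * D0 (e_col j)))" for j
    by (simp add: E_mat_eq ext_diff_cls form_ops)
  note col = finsum_forms[OF this E_term_in_carrier]
  have eq: "E_mat q i j \<odot>\<^bsub>Omega_S2 q\<^esub> ext_diff q (E_mat q j k) =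
    (cls q (e_col i * e_row j * (Dp (e_col j) * free_deg_twist q (e_row k) + e_col j * Dp (e_row k))),
     cls q (e_col i * e_row j * (Dm (e_col j) * free_deg_twist q (e_row k) + e_col j * Dm (e_row k))),
     cls q (e_col i * e_row j * (D0 (e_col j) * free_deg_twist (q ^ 2) (e_row k) + e_col j * D0 (e_row k))))" for j
    by (simp add: E_mat_eq ext_diff_cls form_ops)
  have "ext_diff q (E_mat q j k) \<in> carrier (Omega_S2 q)" for j
    unfolding carrier_Omega_S2 E_mat_eq
    by (intro ext_diff_S2_forms free_homog_mult[OF e_col_homog e_row_homog]) simp
  then have "E_mat q i j \<odot>\<^bsub>Omega_S2 q\<^esub> ext_diff q (E_mat q j k) \<in> carrier (Omega_S2 q)" for j
    by (intro T.smult_M E_mat_cls_in_CqS2)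
  note sum = finsum_forms[OF eq this]
  show ?thesis
    unfolding E_dE_def E_dcol_def col sum E_leibniz by (simp add: ext_diff_cls form_ops)
qed

text \<open>The coordinates vanish by \<open>row_G\<close>. This is what removes the
  \<open>E dcol\<close> term after tensoring.\<close>

lemma row_db: "(\<Oplus>\<^bsub>Omega_S2 q\<^esub>k\<in>UNIV. cls q (e_row k) \<odot>\<^bsub>Omega_S2 q\<^esub> db k) = \<zero>\<^bsub>Omega_S2 q\<^esub>"
proof -
  have "cls q (e_row k) \<odot>\<^bsub>Omega_S2 q\<^esub> db k = (cls q (e_row k * Gp k), cls q (e_row k * Gm k), cls q 0)" for k
    by (simp add: ext_diff_bS2 form_ops del: bS2.simps)
  moreover have "cls q (e_row k) \<odot>\<^bsub>Omega_S2 q\<^esub> db k \<in> carrier (Omega_S2 q)" for k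
    by (intro T.smult_M cls_in_CqS2 e_row_homog forms_in_carrier)
  ultimately show ?thesis
    using finsum_forms[of "\<lambda>k. cls q (e_row k) \<odot>\<^bsub>Omega_S2 q\<^esub> db k" "\<lambda>k. e_row k * Gp k" "\<lambda>k. e_row k * Gm k" "\<lambda>_. 0"]
    by (simp add: row_G form_ops)
qed

lemma ext_diff_scaled:
  assumes "p \<in> free_homog 0"
  shows "ext_diff q (cls q (free_const z * p)) = cls q (free_const z) \<odot>\<^bsub>Omega_S2 q\<^esub> ext_diff q (cls q p)"
    "ext_diff q (cls q (- p)) = \<ominus>\<^bsub>Omega_S2 q\<^esub> ext_diff q (cls q p)"
    "ext_diff q (cls q (1 + p)) = ext_diff q (cls q p)"
proof -
  show "ext_diff q (cls q (free_const z * p)) = cls q (free_const z) \<odot>\<^bsub>Omega_S2 q\<^esub> ext_diff q (cls q p)"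
    "ext_diff q (cls q (1 + p)) = ext_diff q (cls q p)"
    by (simp_all add: ext_diff_cls form_ops)
  have "ext_diff q (cls q p) \<in> carrier (Omega_S2 q)" "ext_diff q (cls q (- p)) \<in> carrier (Omega_S2 q)"
    using assms by (simp_all add: carrier_Omega_S2 ext_diff_S2_forms free_homog_uminus)
  then show "ext_diff q (cls q (- p)) = \<ominus>\<^bsub>Omega_S2 q\<^esub> ext_diff q (cls q p)"
    by (intro T.M.minus_equality[symmetric]) (simp_all add: ext_diff_cls form_ops)
qed

text \<open>Up to sign these are the first tensor factors of the metric, paired with
  \<open>db\<close> of the same index.\<close>

lemma drow_eq:
  "drow Minus = \<ominus>\<^bsub>Omega_S2 q\<^esub> db Plus"
  "drow Zero = const_cls q (two_q q) \<odot>\<^bsub>Omega_S2 q\<^esub> db Zero"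
  "drow Plus = \<ominus>\<^bsub>Omega_S2 q\<^esub> (const_cls q (q ^ 2) \<odot>\<^bsub>Omega_S2 q\<^esub> db Minus)"
proof -
  \<comment> \<open>Each entry gets at most one scalar in front, the shape that
    \<open>ext_diff_scaled\<close> handles.\<close>
  have row: "e_row Minus = - b_elt Plus" "e_row Zero = 1 + free_const (two_q q) * b_elt Zero"
    "e_row Plus = - (free_const (q ^ 2) * b_elt Minus)"
    by (simp_all add: two_q_def free_const_add power2_eq_square free_const_mult)
  show "drow Minus = \<ominus>\<^bsub>Omega_S2 q\<^esub> db Plus"
    "drow Zero = const_cls q (two_q q) \<odot>\<^bsub>Omega_S2 q\<^esub> db Zero"
    "drow Plus = \<ominus>\<^bsub>Omega_S2 q\<^esub> (const_cls q (q ^ 2) \<odot>\<^bsub>Omega_S2 q\<^esub> db Minus)"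
    unfolding row bS2_eq const_cls_def
    by (simp_all only: ext_diff_scaled b_elt_homog free_homog_const_mult)
qed

lemma Omega2_S2_eq: "Omega2_S2 q = tensor_product (CqS2 q) (Omega_S2 q) (Omega_S2 q)"
  and tens_eq: "tens q = pure_tensor (CqS2 q) (Omega_S2 q) (Omega_S2 q)"
  by (simp_all add: Omega2_S2_def tens_def)

end

section \<open>Tensoring \<open>E dE\<close> with the \<open>db\<close> and comparing with the
  connection\<close>

section \<open>The monopole connection\<close>

context quantum_sl2
begin

lemma cls_e_col_in_CqS2: "cls q (e_col i) \<in> carrier (CqS2 q)"
  and cls_e_row_in_CqS2: "cls q (e_row i) \<in> carrier (CqS2 q)"
  and const_in_CqS2: "const_cls q z \<in> carrier (CqS2 q)"
  by (auto simp: const_cls_def intro!: cls_in_CqS2 e_col_homog e_row_homog)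

text \<open>Balancing moves the row entry from the right of \<open>E_dcol i\<close> onto
  \<open>db k\<close>, where \<open>row_db\<close> can act after summation.\<close>

lemma tens_E_dE:
  "tens q (\<ominus>\<^bsub>Omega_S2 q\<^esub> E_dE q i k) (db k) =
   \<ominus>\<^bsub>Omega2_S2 q\<^esub> tens q (E_dcol i) (cls q (e_row k) \<odot>\<^bsub>Omega_S2 q\<^esub> db k)
   \<oplus>\<^bsub>Omega2_S2 q\<^esub> cls q (e_col i) \<odot>\<^bsub>Omega2_S2 q\<^esub> (\<ominus>\<^bsub>Omega2_S2 q\<^esub> tens q (drow k) (db k))"
proof -
  note car = E_dcol_in_carrier forms_in_carrier cls_e_col_in_CqS2 cls_e_row_in_CqS2
  have car': "E_dcol i \<triangleleft>\<^bsub>Omega_S2 q\<^esub> cls q (e_row k) \<in> carrier (Omega_S2 q)"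
    "cls q (e_col i) \<odot>\<^bsub>Omega_S2 q\<^esub> drow k \<in> carrier (Omega_S2 q)"
    "cls q (e_row k) \<odot>\<^bsub>Omega_S2 q\<^esub> db k \<in> carrier (Omega_S2 q)"
    by (intro T.smult_M T.rsmult_M car)+
  then show ?thesis
    unfolding E_dE_eq tens_eq Omega2_S2_eq
    by (simp only: T.tensor_minus_left T.M.a_closed T.tensor_add_left T.tensor_balanced car
        T.smult_tensor[symmetric] T.smult_T_minus T.tensor_in_carrier T.T.minus_add
        T.smult_T_closed)
qed

text \<open>The first tensor factor does not depend on \<open>k\<close>, so the second factors add
  up, to 0 by \<open>row_db\<close>.\<close>

lemma sum_tens_E_dcol:
  "(\<Oplus>\<^bsub>Omega2_S2 q\<^esub>k\<in>UNIV. \<ominus>\<^bsub>Omega2_S2 q\<^esub> tens q (E_dcol i) (cls q (e_row k) \<odot>\<^bsub>Omega_S2 q\<^esub> db k)) = \<zero>\<^bsub>Omega2_S2 q\<^esub>"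
proof -
  have car: "cls q (e_row k) \<odot>\<^bsub>Omega_S2 q\<^esub> db k \<in> carrier (Omega_S2 q)" for k
    by (intro T.smult_M forms_in_carrier cls_e_row_in_CqS2)
  let ?x = "\<lambda>k. cls q (e_row k) \<odot>\<^bsub>Omega_S2 q\<^esub> db k"
  have "?x Minus \<oplus>\<^bsub>Omega_S2 q\<^esub> ?x Zero \<oplus>\<^bsub>Omega_S2 q\<^esub> ?x Plus = \<zero>\<^bsub>Omega_S2 q\<^esub>"
    using row_db T.M.finsum_idx[OF car] by simp
  then have "tens q (E_dcol i) (?x Minus \<oplus>\<^bsub>Omega_S2 q\<^esub> ?x Zero \<oplus>\<^bsub>Omega_S2 q\<^esub> ?x Plus) = \<zero>\<^bsub>Omega2_S2 q\<^esub>"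
    using T.tensor_zero_right[OF E_dcol_in_carrier] unfolding tens_eq Omega2_S2_eq by simp
  then have "tens q (E_dcol i) (?x Minus) \<oplus>\<^bsub>Omega2_S2 q\<^esub> tens q (E_dcol i) (?x Zero)
    \<oplus>\<^bsub>Omega2_S2 q\<^esub> tens q (E_dcol i) (?x Plus) = \<zero>\<^bsub>Omega2_S2 q\<^esub>"
    unfolding tens_eq Omega2_S2_eq
    by (simp only: T.tensor_add_right E_dcol_in_carrier car T.M.a_closed)
  then have "\<ominus>\<^bsub>Omega2_S2 q\<^esub> (tens q (E_dcol i) (?x Minus) \<oplus>\<^bsub>Omega2_S2 q\<^esub> tens q (E_dcol i) (?x Zero)
    \<oplus>\<^bsub>Omega2_S2 q\<^esub> tens q (E_dcol i) (?x Plus)) = \<zero>\<^bsub>Omega2_S2 q\<^esub>"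
    unfolding Omega2_S2_eq by (simp only: T.T.minus_equality[OF T.T.l_zero T.T.zero_closed] T.T.zero_closed)
  then show ?thesis
    unfolding tens_eq Omega2_S2_eq
    by (subst T.T.finsum_idx)
      (simp_all only: T.T.minus_add T.tensor_in_carrier T.T.a_closed T.T.a_inv_closed E_dcol_in_carrier car)
qed

text \<open>By \<open>drow_eq\<close> the three summands are those of the metric in another
  order.\<close>

lemma sum_tens_drow:
  "(\<Oplus>\<^bsub>Omega2_S2 q\<^esub>k\<in>UNIV. \<ominus>\<^bsub>Omega2_S2 q\<^esub> tens q (drow k) (db k)) = metric_g q"
proof -
  note car = forms_in_carrier const_in_CqS2 T.smult_M
  have "\<ominus>\<^bsub>Omega2_S2 q\<^esub> tens q (drow Minus) (db Minus) = tens q (db Plus) (db Minus)"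
    "\<ominus>\<^bsub>Omega2_S2 q\<^esub> tens q (drow Zero) (db Zero) =
      \<ominus>\<^bsub>Omega2_S2 q\<^esub> (const_cls q (two_q q) \<odot>\<^bsub>Omega2_S2 q\<^esub> tens q (db Zero) (db Zero))"
    "\<ominus>\<^bsub>Omega2_S2 q\<^esub> tens q (drow Plus) (db Plus) =
      const_cls q (q ^ 2) \<odot>\<^bsub>Omega2_S2 q\<^esub> tens q (db Minus) (db Plus)"
    unfolding drow_eq tens_eq Omega2_S2_eq
    by (simp_all only: T.tensor_minus_left car T.T.minus_minus T.tensor_in_carrier T.smult_tensor)
  moreover have "\<ominus>\<^bsub>Omega2_S2 q\<^esub> tens q (drow k) (db k) \<in> carrier (Omega2_S2 q)" for k
    unfolding tens_eq Omega2_S2_eq by (intro T.T.a_inv_closed T.tensor_in_carrier car)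
  moreover have "tens q (db i) (db j) \<in> carrier (Omega2_S2 q)"
    "const_cls q z \<odot>\<^bsub>Omega2_S2 q\<^esub> tens q (db i) (db j) \<in> carrier (Omega2_S2 q)" for i j z
    unfolding tens_eq Omega2_S2_eq by (intro T.smult_T_closed T.tensor_in_carrier car)+
  ultimately show ?thesis
    unfolding metric_g_def a_minus_def Omega2_S2_eq
    by (subst T.T.finsum_idx)
      (simp_all only: T.T.a_ac T.T.a_closed T.T.a_inv_closed)
qed

text \<open>The sum splits by \<open>tens_E_dE\<close> into a vanishing part and the column entry
  times the sum that equals the metric.\<close>

lemma sum_tens_E_dE:
  "(\<Oplus>\<^bsub>Omega2_S2 q\<^esub>k\<in>UNIV. tens q (\<ominus>\<^bsub>Omega_S2 q\<^esub> E_dE q i k) (db k)) =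
    cls q (e_col i) \<odot>\<^bsub>Omega2_S2 q\<^esub> metric_g q"
proof -
  let ?x = "\<lambda>k. \<ominus>\<^bsub>Omega2_S2 q\<^esub> tens q (E_dcol i) (cls q (e_row k) \<odot>\<^bsub>Omega_S2 q\<^esub> db k)"
  let ?y = "\<lambda>k. \<ominus>\<^bsub>Omega2_S2 q\<^esub> tens q (drow k) (db k)"
  have x: "?x k \<in> carrier (Omega2_S2 q)" and y: "?y k \<in> carrier (Omega2_S2 q)" for k
    unfolding tens_eq Omega2_S2_eq
    by (intro T.T.a_inv_closed T.tensor_in_carrier T.smult_M forms_in_carrier E_dcol_in_carrier cls_e_row_in_CqS2)+
  note z = T.smult_T_closed[OF cls_e_col_in_CqS2, folded Omega2_S2_eq, OF y]
  have "(\<Oplus>\<^bsub>Omega2_S2 q\<^esub>k\<in>UNIV. ?x k \<oplus>\<^bsub>Omega2_S2 q\<^esub> cls q (e_col i) \<odot>\<^bsub>Omega2_S2 q\<^esub> ?y k) =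
    (\<Oplus>\<^bsub>Omega2_S2 q\<^esub>k\<in>UNIV. ?x k) \<oplus>\<^bsub>Omega2_S2 q\<^esub> (\<Oplus>\<^bsub>Omega2_S2 q\<^esub>k\<in>UNIV. cls q (e_col i) \<odot>\<^bsub>Omega2_S2 q\<^esub> ?y k)"
    using x z unfolding Omega2_S2_eq by (intro T.T.finsum_addf) auto
  also have "(\<Oplus>\<^bsub>Omega2_S2 q\<^esub>k\<in>UNIV. cls q (e_col i) \<odot>\<^bsub>Omega2_S2 q\<^esub> ?y k) =
    cls q (e_col i) \<odot>\<^bsub>Omega2_S2 q\<^esub> (\<Oplus>\<^bsub>Omega2_S2 q\<^esub>k\<in>UNIV. ?y k)"
    using y z unfolding Omega2_S2_eq
    by (simp only: T.T.finsum_idx T.smult_T_add cls_e_col_in_CqS2 T.T.a_closed)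
  also have "(\<Oplus>\<^bsub>Omega2_S2 q\<^esub>k\<in>UNIV. ?x k) = \<zero>\<^bsub>Omega2_S2 q\<^esub>"
    by (rule sum_tens_E_dcol)
  also have "\<zero>\<^bsub>Omega2_S2 q\<^esub> \<oplus>\<^bsub>Omega2_S2 q\<^esub> cls q (e_col i) \<odot>\<^bsub>Omega2_S2 q\<^esub> (\<Oplus>\<^bsub>Omega2_S2 q\<^esub>k\<in>UNIV. ?y k) =
    cls q (e_col i) \<odot>\<^bsub>Omega2_S2 q\<^esub> (\<Oplus>\<^bsub>Omega2_S2 q\<^esub>k\<in>UNIV. ?y k)"
    using y unfolding Omega2_S2_eq
    by (intro T.T.l_zero T.smult_T_closed cls_e_col_in_CqS2 T.T.finsum_closed) auto
  finally show ?thesis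
    unfolding tens_E_dE sum_tens_drow .
qed

text \<open>The values prescribed for the connection on the three \<open>db\<close> are exactly the
  column entries of \<open>E\<close> times the metric.\<close>

lemma monopole_connection_eq:
  assumes "monopole_connection q nabla"
  shows "nabla (db i) =
    (\<Oplus>\<^bsub>Omega2_S2 q\<^esub>k\<in>UNIV. tens q (\<ominus>\<^bsub>Omega_S2 q\<^esub> E_dE q i k) (db k))"
  unfolding sum_tens_E_dE E_col_eq[symmetric]
  using assms by (cases i) (simp_all only: monopole_connection_def E_col.simps)

end

theorem corollary5p2:
  fixes q :: complex
  assumes "q \<noteq> 0"
  shows "E_mat q \<in> carrier (mat_ring (CqS2 q)) \<and>
         E_mat q \<otimes>\<^bsub>mat_ring (CqS2 q)\<^esub> E_mat q = E_mat q \<and>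
         left_module_iso (CqS2 q)
           (row_module_times (CqS2 q) (\<one>\<^bsub>mat_ring (CqS2 q)\<^esub> \<ominus>\<^bsub>mat_ring (CqS2 q)\<^esub> E_mat q))
           (Omega_S2 q)
           (\<lambda>v. v Minus \<odot>\<^bsub>Omega_S2 q\<^esub> ext_diff q (bS2 q Minus)
                \<oplus>\<^bsub>Omega_S2 q\<^esub> v Zero \<odot>\<^bsub>Omega_S2 q\<^esub> ext_diff q (bS2 q Zero)
                \<oplus>\<^bsub>Omega_S2 q\<^esub> v Plus \<odot>\<^bsub>Omega_S2 q\<^esub> ext_diff q (bS2 q Plus)) \<and>
         (\<forall>nabla. monopole_connection q nabla \<longrightarrow>
            (\<forall>i. nabla (ext_diff q (bS2 q i)) =
                 (\<Oplus>\<^bsub>Omega2_S2 q\<^esub>k\<in>UNIV.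
                    tens q (\<ominus>\<^bsub>Omega_S2 q\<^esub> E_dE q i k) (ext_diff q (bS2 q k)))))"
proof -
  interpret quantum_sl2 q
    by unfold_locales (rule assms)
  show ?thesis
    using E_mat_in_carrier E_mat_idem frame_map_iso[unfolded frame_map_def[abs_def]] monopole_connection_eq
    by blast
qed

end
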